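(* Let $T$ be a recursively enumerable extension of Robinson's arithmetic $\mathbf{Q}$, and let $n\geqslant 1$. (a) All the Gödelian $\Pi_{n+1}$-sentences of $T$ are true if and only if $T$ is $\Pi_{n+1}$-sound. (b) All the Gödelian $\Sigma_{n+1}$-sentences of $T$ are true if and only if $T$ is $\Sigma_{n+1}$-sound.
   Context: All theories and sentences are in the language of first-order arithmetic; "true" means true in the standard model $\mathbb{N}$. A fixed Gödel numbering of the syntax is given, and $\#A$ denotes the numeral of the Gödel code of the expression $A$. $\mathrm{Pr}_T(x)$ is a fixed provability predicate of $T$ relative to this numbering: a $\Sigma_1$-formula such that for every sentence $\varphi$: $T\vdash\varphi \iff \mathbb{N}\vDash\mathrm{Pr}_T(\#\varphi) \iff \mathbf{Q}\vdash\mathrm{Pr}_T(\#\varphi)$. A sentence $\gamma$ is a Gödelian sentence of $T$ when $T\vdash\gamma\leftrightarrow\neg\mathrm{Pr}_T(\#\gamma)$; a Gödelian $\Gamma$-sentence is a Gödelian sentence belonging to the class $\Gamma$. For a class $\Gamma$ of sentences, a theory $S$ is $\Gamma$-sound when every $S$-provable $\Gamma$-sentence is true. The classes $\Sigma_n,\Pi_n$ are the usual arithmetical classes of formulas (as usual, a formula logically equivalent to one in the class is counted as belonging to it). *)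

theory Defs
  imports Main
begin

section \<open>Syntax of first-order arithmetic\<close>

text \<open>
  The language has \<open>0\<close>, successor, \<open>+\<close>, \<open>\<cdot>\<close>, \<open>\<le>\<close> and equality. Variables are de Bruijn indices:
  in \<^term>\<open>Forall \<phi>\<close> the index \<open>0\<close> of \<^term>\<open>\<phi>\<close> is bound. The connectives other than
  \<open>\<bottom>\<close>, \<open>\<rightarrow>\<close> and \<open>\<forall>\<close> are classical abbreviations.
\<close>

datatype tm = Var nat | Zero | Sc tm | Add tm tm | Mul tm tm

datatype fm = Eq tm tm | Le tm tm | Bot | Imp fm fm | Forall fm

abbreviation Neg :: "fm \<Rightarrow> fm" where "Neg \<phi> \<equiv> Imp \<phi> Bot"
abbreviation Or :: "fm \<Rightarrow> fm \<Rightarrow> fm" where "Or \<phi> \<psi> \<equiv> Imp (Neg \<phi>) \<psi>"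
abbreviation And :: "fm \<Rightarrow> fm \<Rightarrow> fm" where "And \<phi> \<psi> \<equiv> Neg (Imp \<phi> (Neg \<psi>))"
abbreviation Iff :: "fm \<Rightarrow> fm \<Rightarrow> fm" where "Iff \<phi> \<psi> \<equiv> And (Imp \<phi> \<psi>) (Imp \<psi> \<phi>)"
abbreviation Exists :: "fm \<Rightarrow> fm" where "Exists \<phi> \<equiv> Neg (Forall (Neg \<phi>))"

primrec fv_tm :: "tm \<Rightarrow> nat set" where
  "fv_tm (Var i) = {i}"
| "fv_tm Zero = {}"
| "fv_tm (Sc t) = fv_tm t"
| "fv_tm (Add s t) = fv_tm s \<union> fv_tm t"
| "fv_tm (Mul s t) = fv_tm s \<union> fv_tm t"

primrec fv :: "fm \<Rightarrow> nat set" where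
  "fv (Eq s t) = fv_tm s \<union> fv_tm t"
| "fv (Le s t) = fv_tm s \<union> fv_tm t"
| "fv Bot = {}"
| "fv (Imp \<phi> \<psi>) = fv \<phi> \<union> fv \<psi>"
| "fv (Forall \<phi>) = {i. Suc i \<in> fv \<phi>}"

definition sentence :: "fm \<Rightarrow> bool" where
  "sentence \<phi> \<longleftrightarrow> fv \<phi> = {}"

primrec subst_tm :: "(nat \<Rightarrow> tm) \<Rightarrow> tm \<Rightarrow> tm" where
  "subst_tm \<sigma> (Var i) = \<sigma> i"
| "subst_tm \<sigma> Zero = Zero"
| "subst_tm \<sigma> (Sc t) = Sc (subst_tm \<sigma> t)"
| "subst_tm \<sigma> (Add s t) = Add (subst_tm \<sigma> s) (subst_tm \<sigma> t)"
| "subst_tm \<sigma> (Mul s t) = Mul (subst_tm \<sigma> s) (subst_tm \<sigma> t)"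

definition lift_tm :: "tm \<Rightarrow> tm" where
  "lift_tm = subst_tm (\<lambda>i. Var (Suc i))"

definition under_binder :: "(nat \<Rightarrow> tm) \<Rightarrow> nat \<Rightarrow> tm" where
  "under_binder \<sigma> = case_nat (Var 0) (\<lambda>i. lift_tm (\<sigma> i))"

primrec subst :: "(nat \<Rightarrow> tm) \<Rightarrow> fm \<Rightarrow> fm" where
  "subst \<sigma> (Eq s t) = Eq (subst_tm \<sigma> s) (subst_tm \<sigma> t)"
| "subst \<sigma> (Le s t) = Le (subst_tm \<sigma> s) (subst_tm \<sigma> t)"
| "subst \<sigma> Bot = Bot"
| "subst \<sigma> (Imp \<phi> \<psi>) = Imp (subst \<sigma> \<phi>) (subst \<sigma> \<psi>)"
| "subst \<sigma> (Forall \<phi>) = Forall (subst (under_binder \<sigma>) \<phi>)"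

definition lift :: "fm \<Rightarrow> fm" where
  "lift = subst (\<lambda>i. Var (Suc i))"

text \<open>Replace index \<open>0\<close> by \<open>t\<close> and decrement all other indices.\<close>

definition inst :: "tm \<Rightarrow> fm \<Rightarrow> fm" where
  "inst t = subst (case_nat t Var)"

definition numeral_tm :: "nat \<Rightarrow> tm" where
  "numeral_tm k = (Sc ^^ k) Zero"

section \<open>Provability\<close>

text \<open>
  Classical natural deduction with equality. In \<open>ForallI\<close> lifting the hypotheses makes index \<open>0\<close>
  an eigenvariable.
\<close>

inductive provable :: "fm set \<Rightarrow> fm \<Rightarrow> bool" (infix "\<turnstile>" 50) where
  Hyp: "\<phi> \<in> \<Gamma> \<Longrightarrow> \<Gamma> \<turnstile> \<phi>"
| ImpI: "insert \<phi> \<Gamma> \<turnstile> \<psi> \<Longrightarrow> \<Gamma> \<turnstile> Imp \<phi> \<psi>"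
| ImpE: "\<Gamma> \<turnstile> Imp \<phi> \<psi> \<Longrightarrow> \<Gamma> \<turnstile> \<phi> \<Longrightarrow> \<Gamma> \<turnstile> \<psi>"
| Contr: "insert (Neg \<phi>) \<Gamma> \<turnstile> Bot \<Longrightarrow> \<Gamma> \<turnstile> \<phi>"
| ForallI: "lift ` \<Gamma> \<turnstile> \<phi> \<Longrightarrow> \<Gamma> \<turnstile> Forall \<phi>"
| ForallE: "\<Gamma> \<turnstile> Forall \<phi> \<Longrightarrow> \<Gamma> \<turnstile> inst t \<phi>"
| EqRefl: "\<Gamma> \<turnstile> Eq t t"
| EqSubst: "\<Gamma> \<turnstile> Eq s t \<Longrightarrow> \<Gamma> \<turnstile> inst s \<phi> \<Longrightarrow> \<Gamma> \<turnstile> inst t \<phi>"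

section \<open>Truth in the standard model\<close>

primrec val :: "(nat \<Rightarrow> nat) \<Rightarrow> tm \<Rightarrow> nat" where
  "val e (Var i) = e i"
| "val e Zero = 0"
| "val e (Sc t) = Suc (val e t)"
| "val e (Add s t) = val e s + val e t"
| "val e (Mul s t) = val e s * val e t"

primrec sat :: "(nat \<Rightarrow> nat) \<Rightarrow> fm \<Rightarrow> bool" where
  "sat e (Eq s t) \<longleftrightarrow> val e s = val e t"
| "sat e (Le s t) \<longleftrightarrow> val e s \<le> val e t"
| "sat e Bot \<longleftrightarrow> False"
| "sat e (Imp \<phi> \<psi>) \<longleftrightarrow> (sat e \<phi> \<longrightarrow> sat e \<psi>)"
| "sat e (Forall \<phi>) \<longleftrightarrow> (\<forall>m. sat (case_nat m e) \<phi>)"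

definition true_in_N :: "fm \<Rightarrow> bool" where
  "true_in_N \<phi> \<longleftrightarrow> (\<forall>e. sat e \<phi>)"

section \<open>Robinson's arithmetic\<close>

definition robinson_Q :: "fm set" where
  "robinson_Q =
    {Forall (Neg (Eq (Sc (Var 0)) Zero)),
     Forall (Forall (Imp (Eq (Sc (Var 1)) (Sc (Var 0))) (Eq (Var 1) (Var 0)))),
     Forall (Imp (Neg (Eq (Var 0) Zero)) (Exists (Eq (Var 1) (Sc (Var 0))))),
     Forall (Eq (Add (Var 0) Zero) (Var 0)),
     Forall (Forall (Eq (Add (Var 1) (Sc (Var 0))) (Sc (Add (Var 1) (Var 0))))),
     Forall (Eq (Mul (Var 0) Zero) Zero),
     Forall (Forall (Eq (Mul (Var 1) (Sc (Var 0))) (Add (Mul (Var 1) (Var 0)) (Var 1)))),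
     Forall (Forall (Iff (Le (Var 1) (Var 0)) (Exists (Eq (Add (Var 0) (Var 2)) (Var 1)))))}"

section \<open>The arithmetical classes\<close>

text \<open>
  In a bounded quantifier the bounding term does not contain the bound variable, hence the lifted
  term.
\<close>

inductive_set delta0 :: "fm set" where
  "Eq s t \<in> delta0"
| "Le s t \<in> delta0"
| "Bot \<in> delta0"
| "\<phi> \<in> delta0 \<Longrightarrow> \<psi> \<in> delta0 \<Longrightarrow> Imp \<phi> \<psi> \<in> delta0"
| "\<phi> \<in> delta0 \<Longrightarrow> Forall (Imp (Le (Var 0) (lift_tm t)) \<phi>) \<in> delta0"
| "\<phi> \<in> delta0 \<Longrightarrow> Exists (And (Le (Var 0) (lift_tm t)) \<phi>) \<in> delta0"

text \<open>
  The prenex classes: \<open>n\<close> alternating (possibly empty) blocks of unbounded quantifiers in front of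
  a bounded formula.
\<close>

fun sigma_prenex :: "nat \<Rightarrow> fm set" and pi_prenex :: "nat \<Rightarrow> fm set" where
  "sigma_prenex 0 = delta0"
| "pi_prenex 0 = delta0"
| "sigma_prenex (Suc n) = {(Exists ^^ k) \<phi> |k \<phi>. \<phi> \<in> pi_prenex n}"
| "pi_prenex (Suc n) = {(Forall ^^ k) \<phi> |k \<phi>. \<phi> \<in> sigma_prenex n}"

definition Sigma_class :: "nat \<Rightarrow> fm set" where
  "Sigma_class n = {\<phi>. \<exists>\<psi>\<in>sigma_prenex n. {} \<turnstile> Iff \<phi> \<psi>}"

definition Pi_class :: "nat \<Rightarrow> fm set" where
  "Pi_class n = {\<phi>. \<exists>\<psi>\<in>pi_prenex n. {} \<turnstile> Iff \<phi> \<psi>}"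

definition sound_for :: "fm set \<Rightarrow> fm set \<Rightarrow> bool" where
  "sound_for C T \<longleftrightarrow> (\<forall>\<phi>. sentence \<phi> \<and> \<phi> \<in> C \<and> T \<turnstile> \<phi> \<longrightarrow> true_in_N \<phi>)"

section \<open>Computability\<close>

text \<open>
  Programs for Kleene's \<open>\<mu>\<close>-recursive functions; \<^term>\<open>run p xs y\<close> means that the partial function
  denoted by \<^term>\<open>p\<close> converges at \<^term>\<open>xs\<close> with value \<^term>\<open>y\<close>.
\<close>

datatype prog = PZero | PSucc | PProj nat | PComp prog "prog list" | PRec prog prog | PMin prog

inductive run :: "prog \<Rightarrow> nat list \<Rightarrow> nat \<Rightarrow> bool" where
  run_zero: "run PZero xs 0"
| run_succ: "run PSucc [x] (Suc x)"
| run_proj: "i < length xs \<Longrightarrow> run (PProj i) xs (xs ! i)"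
| run_comp: "list_all2 (\<lambda>q y. run q xs y) qs ys \<Longrightarrow> run p ys z \<Longrightarrow> run (PComp p qs) xs z"
| run_rec_0: "run p xs y \<Longrightarrow> run (PRec p q) (0 # xs) y"
| run_rec_Suc: "run (PRec p q) (m # xs) y \<Longrightarrow> run q (m # y # xs) z
    \<Longrightarrow> run (PRec p q) (Suc m # xs) z"
| run_min: "run p (m # xs) 0 \<Longrightarrow> (\<And>i. i < m \<Longrightarrow> \<exists>y. run p (i # xs) (Suc y))
    \<Longrightarrow> run (PMin p) xs m"

definition recursive1 :: "(nat \<Rightarrow> nat) \<Rightarrow> bool" where
  "recursive1 f \<longleftrightarrow> (\<exists>p. \<forall>x y. run p [x] y \<longleftrightarrow> y = f x)"

definition recursive2 :: "(nat \<Rightarrow> nat \<Rightarrow> nat) \<Rightarrow> bool" where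
  "recursive2 f \<longleftrightarrow> (\<exists>p. \<forall>x1 x2 y. run p [x1, x2] y \<longleftrightarrow> y = f x1 x2)"

definition decidable :: "nat set \<Rightarrow> bool" where
  "decidable A \<longleftrightarrow> recursive1 (\<lambda>x. if x \<in> A then 1 else 0)"

definition rec_enumerable :: "nat set \<Rightarrow> bool" where
  "rec_enumerable A \<longleftrightarrow> (\<exists>p. \<forall>x. x \<in> A \<longleftrightarrow> (\<exists>y. run p [x] y))"

section \<open>Goedel numberings and provability predicates\<close>

text \<open>
  A Goedel numbering assigns codes to terms and formulas injectively and effectively: it is
  decidable whether a number is a code, and each syntactic constructor acts recursively on codes.
  (Decoding is then recursive as well, by search.)
\<close>

definition goedel_numbering :: "(tm \<Rightarrow> nat) \<Rightarrow> (fm \<Rightarrow> nat) \<Rightarrow> bool" where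
  "goedel_numbering gt gf \<longleftrightarrow>
     inj gt \<and> inj gf \<and> decidable (range gt) \<and> decidable (range gf) \<and>
     (\<exists>f. recursive1 f \<and> (\<forall>i. gt (Var i) = f i)) \<and>
     (\<exists>f. recursive1 f \<and> (\<forall>t. gt (Sc t) = f (gt t))) \<and>
     (\<exists>f. recursive2 f \<and> (\<forall>s t. gt (Add s t) = f (gt s) (gt t))) \<and>
     (\<exists>f. recursive2 f \<and> (\<forall>s t. gt (Mul s t) = f (gt s) (gt t))) \<and>
     (\<exists>f. recursive2 f \<and> (\<forall>s t. gf (Eq s t) = f (gt s) (gt t))) \<and>
     (\<exists>f. recursive2 f \<and> (\<forall>s t. gf (Le s t) = f (gt s) (gt t))) \<and>
     (\<exists>f. recursive2 f \<and> (\<forall>\<phi> \<psi>. gf (Imp \<phi> \<psi>) = f (gf \<phi>) (gf \<psi>))) \<and>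
     (\<exists>f. recursive1 f \<and> (\<forall>\<phi>. gf (Forall \<phi>) = f (gf \<phi>)))"

text \<open>The sentence \<open>Pr(#\<phi>)\<close>.\<close>

definition at_code :: "(fm \<Rightarrow> nat) \<Rightarrow> fm \<Rightarrow> fm \<Rightarrow> fm" where
  "at_code gf Pr \<phi> = inst (numeral_tm (gf \<phi>)) Pr"

definition provability_predicate :: "(fm \<Rightarrow> nat) \<Rightarrow> fm set \<Rightarrow> fm \<Rightarrow> bool" where
  "provability_predicate gf T Pr \<longleftrightarrow>
     fv Pr \<subseteq> {0} \<and> Pr \<in> Sigma_class 1 \<and>
     (\<forall>\<phi>. sentence \<phi> \<longrightarrow>
        (T \<turnstile> \<phi> \<longleftrightarrow> true_in_N (at_code gf Pr \<phi>)) \<and>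
        (true_in_N (at_code gf Pr \<phi>) \<longleftrightarrow> robinson_Q \<turnstile> at_code gf Pr \<phi>))"

definition goedelian :: "(fm \<Rightarrow> nat) \<Rightarrow> fm set \<Rightarrow> fm \<Rightarrow> fm \<Rightarrow> bool" where
  "goedelian gf T Pr \<gamma> \<longleftrightarrow> sentence \<gamma> \<and> T \<turnstile> Iff \<gamma> (Neg (at_code gf Pr \<gamma>))"

definition re_extension_of_Q :: "(fm \<Rightarrow> nat) \<Rightarrow> fm set \<Rightarrow> bool" where
  "re_extension_of_Q gf T \<longleftrightarrow>
     (\<forall>\<phi>\<in>T. sentence \<phi>) \<and> rec_enumerable (gf ` T) \<and> (\<forall>\<phi>\<in>robinson_Q. T \<turnstile> \<phi>)"

end

theory Submission
  imports Defs "HOL-Library.Countable" "HOL-Number_Theory.Cong"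
begin

text \<open>
  Let \<open>C\<close> be one of the classes \<open>\<Pi>\<^bsub>n+1\<^esub>\<close>, \<open>\<Sigma>\<^bsub>n+1\<^esub>\<close> with \<open>n \<ge> 1\<close>. The proof uses two facts about \<open>C\<close>
  only: it is closed under conjunction with \<open>\<Pi>\<^sub>1\<close> formulas and under disjunction with \<open>\<Sigma>\<^sub>1\<close> formulas.

  Suppose that \<open>T\<close> is \<open>C\<close>-sound and that \<open>\<gamma> \<in> C\<close> is Goedelian. Then \<open>T\<close> proves \<open>\<gamma> \<or> Pr(#\<gamma>)\<close>. This
  disjunction lies in \<open>C\<close>, so it is true. If its second disjunct is true, then \<open>T\<close> proves \<open>\<gamma>\<close>, and
  soundness, applied again, shows that \<open>\<gamma>\<close> is true.

  Suppose that all Goedelian sentences in \<open>C\<close> are true and that \<open>T\<close> proves the sentence \<open>\<phi> \<in> C\<close>. It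
  suffices to find a Goedelian sentence in \<open>C\<close> that implies \<open>\<phi>\<close>. Diagonalization gives a \<open>\<Pi>\<^sub>1\<close> sentence
  \<open>\<delta>\<close> which says, provably in \<open>T\<close>, that \<open>\<phi> \<and> \<delta>\<close> is not \<open>T\<close>-provable. Since \<open>T\<close> proves \<open>\<phi>\<close>, it
  proves that \<open>\<phi> \<and> \<delta>\<close> is equivalent to \<open>\<delta>\<close>, so \<open>\<phi> \<and> \<delta>\<close> is the required sentence
  (lemma \<open>goedelian_conjunct\<close>).

  The work lies in the fixed point. The theory \<open>T\<close> may prove false \<open>\<Sigma>\<^sub>1\<close> sentences, so a formula that
  defines the diagonal function in the standard model is not enough: its value must be determined
  in \<open>T\<close>. Three ideas carry this part.

  \<^item> By the completeness theorem, derivability from sentences is truth in all models. Membership in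
    the arithmetical classes and the reasoning inside \<open>Q\<close> become statements about structures, and
    derivations are handled in the proofs of soundness and completeness only.

  \<^item> In a model of \<open>Q\<close> the numerals form an initial segment, so bounded formulas keep their standard
    truth values there. The graph of a recursive function is defined in the standard model by
    \<open>\<exists>w. A(w, y, x)\<close> with \<open>A\<close> bounded. If one also requires \<open>w\<close> to be the least bound for a witness, the
    resulting \<open>\<Sigma>\<^sub>1\<close> formula has, for each numeral \<open>x\<close>, the correct \<open>y\<close> as its only solution in every
    model of \<open>Q\<close>, nonstandard ones included (theorem \<open>representable\<close>).

  \<^item> The diagonal function sends \<open>F\<close> to \<open>\<forall>x. x = #F \<longrightarrow> F(x)\<close> instead of \<open>F(#F)\<close>. Its effect on codes is
    composed from the syntactic constructors and the code of a numeral, and no substitution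
    function on codes has to be shown recursive.
\<close>

section \<open>Substitution\<close>

lemma subst_tm_subst_tm: "subst_tm \<sigma> (subst_tm \<tau> t) = subst_tm (\<lambda>i. subst_tm \<sigma> (\<tau> i)) t"
  by (induction t) auto

lemma under_binder_simps [simp]:
  "under_binder \<sigma> 0 = Var 0" "under_binder \<sigma> (Suc i) = lift_tm (\<sigma> i)"
  by (auto simp: under_binder_def)

lemma lift_tm_subst_tm: "lift_tm (subst_tm \<sigma> t) = subst_tm (under_binder \<sigma>) (lift_tm t)"
  by (simp add: lift_tm_def subst_tm_subst_tm)

lemma subst_subst: "subst \<sigma> (subst \<tau> \<phi>) = subst (\<lambda>i. subst_tm \<sigma> (\<tau> i)) \<phi>"
proof (induction \<phi> arbitrary: \<sigma> \<tau>)
  case (Forall \<phi>)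
  have "(\<lambda>i. subst_tm (under_binder \<sigma>) (under_binder \<tau> i)) = under_binder (\<lambda>i. subst_tm \<sigma> (\<tau> i))"
    by (rule ext, case_tac i) (auto simp: lift_tm_subst_tm)
  then show ?case by (simp add: Forall)
qed (auto simp: subst_tm_subst_tm)

lemma subst_tm_cong: "(\<And>i. i \<in> fv_tm t \<Longrightarrow> \<sigma> i = \<tau> i) \<Longrightarrow> subst_tm \<sigma> t = subst_tm \<tau> t"
  by (induction t) auto

lemma subst_cong: "(\<And>i. i \<in> fv \<phi> \<Longrightarrow> \<sigma> i = \<tau> i) \<Longrightarrow> subst \<sigma> \<phi> = subst \<tau> \<phi>"
proof (induction \<phi> arbitrary: \<sigma> \<tau>)
  case (Eq s t) then show ?case by (auto intro!: subst_tm_cong)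
next
  case (Le s t) then show ?case by (auto intro!: subst_tm_cong)
next
  case (Imp \<phi> \<psi>)
  have "subst \<sigma> \<phi> = subst \<tau> \<phi>" using Imp.prems by (intro Imp.IH) auto
  moreover have "subst \<sigma> \<psi> = subst \<tau> \<psi>" using Imp.prems by (intro Imp.IH) auto
  ultimately show ?case by simp
next
  case (Forall \<phi>)
  have "subst (under_binder \<sigma>) \<phi> = subst (under_binder \<tau>) \<phi>"
  proof (rule Forall.IH)
    fix i assume "i \<in> fv \<phi>"
    then show "under_binder \<sigma> i = under_binder \<tau> i"
      by (cases i) (auto simp: Forall.prems)
  qed
  then show ?case by simp
qed simp

lemma subst_tm_Var [simp]: "subst_tm Var t = t"
  by (induction t) auto

lemma under_binder_Var [simp]: "under_binder Var = Var"
  by (rule ext, case_tac x) (auto simp: lift_tm_def)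

lemma subst_Var [simp]: "subst Var \<phi> = \<phi>"
  by (induction \<phi>) auto

lemma subst_tm_case_nat_lift [simp]: "subst_tm (case_nat t \<sigma>) (lift_tm s) = subst_tm \<sigma> s"
  by (simp add: lift_tm_def subst_tm_subst_tm)

lemma subst_under_binder_inst: "inst t (subst (under_binder \<sigma>) \<phi>) = subst (case_nat t \<sigma>) \<phi>"
proof -
  have "(\<lambda>i. subst_tm (case_nat t Var) (under_binder \<sigma> i)) = case_nat t \<sigma>"
    by (rule ext, case_tac i) auto
  then show ?thesis by (simp add: inst_def subst_subst)
qed

lemma subst_inst: "subst \<sigma> (inst t \<phi>) = inst (subst_tm \<sigma> t) (subst (under_binder \<sigma>) \<phi>)"
proof -
  have "(\<lambda>i. subst_tm \<sigma> (case i of 0 \<Rightarrow> t | Suc j \<Rightarrow> Var j)) = case_nat (subst_tm \<sigma> t) \<sigma>"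
    by (rule ext, case_tac i) auto
  then show ?thesis by (simp add: subst_under_binder_inst) (simp add: inst_def subst_subst)
qed

lemma subst_lift: "subst (under_binder \<sigma>) (lift \<phi>) = lift (subst \<sigma> \<phi>)"
  by (simp add: lift_def subst_subst) (simp add: lift_tm_def)

lemma fv_subst_tm: "fv_tm (subst_tm \<sigma> t) = (\<Union>i\<in>fv_tm t. fv_tm (\<sigma> i))"
  by (induction t) auto

lemma fv_lift_tm: "fv_tm (lift_tm t) = Suc ` fv_tm t"
  by (auto simp: lift_tm_def fv_subst_tm)

lemma fv_subst: "fv (subst \<sigma> \<phi>) = (\<Union>i\<in>fv \<phi>. fv_tm (\<sigma> i))"
proof (induction \<phi> arbitrary: \<sigma>)
  case (Forall \<phi>)
  have "Suc j \<in> fv_tm (under_binder \<sigma> i) \<longleftrightarrow> (\<exists>k. i = Suc k \<and> j \<in> fv_tm (\<sigma> k))" for i j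
    by (cases i) (auto simp: fv_lift_tm)
  then show ?case by (auto simp: Forall)
qed (auto simp: fv_subst_tm)

lemma finite_fv_tm [simp]: "finite (fv_tm t)"
  by (induction t) auto

lemma finite_fv [simp]: "finite (fv \<phi>)"
proof (induction \<phi>)
  case (Forall \<phi>)
  have "finite (Suc -` fv \<phi>)" using Forall by (intro finite_vimageI) auto
  then show ?case by (simp add: vimage_def)
qed auto

lemma fv_tm_numeral [simp]: "fv_tm (numeral_tm k) = {}"
  by (induction k) (auto simp: numeral_tm_def)

section \<open>Derivations\<close>

lemma weaken: "\<Gamma> \<turnstile> \<phi> \<Longrightarrow> \<Gamma> \<subseteq> \<Delta> \<Longrightarrow> \<Delta> \<turnstile> \<phi>"
proof (induction arbitrary: \<Delta> rule: provable.induct)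
  case (ImpI \<phi> \<Gamma> \<psi>) then show ?case by (meson insert_mono provable.ImpI)
next
  case (Contr \<phi> \<Gamma>) then show ?case by (meson insert_mono provable.Contr)
next
  case (ForallI \<Gamma> \<phi>) then show ?case by (meson image_mono provable.ForallI)
next
  case (EqSubst \<Gamma> s t \<phi>) then show ?case by (meson provable.EqSubst)
qed (auto intro: provable.intros)

lemma provable_finite: "\<Gamma> \<turnstile> \<phi> \<Longrightarrow> \<exists>\<Delta>\<subseteq>\<Gamma>. finite \<Delta> \<and> \<Delta> \<turnstile> \<phi>"
proof (induction rule: provable.induct)
  case (Hyp \<phi> \<Gamma>)
  then show ?case by (intro exI[of _ "{\<phi>}"]) (auto intro: provable.Hyp)
next
  case (ImpI \<phi> \<Gamma> \<psi>)
  then obtain \<Delta> where "\<Delta> \<subseteq> insert \<phi> \<Gamma>" "finite \<Delta>" "\<Delta> \<turnstile> \<psi>" by auto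
  then show ?case
    using provable.ImpI[OF weaken[of \<Delta> \<psi> "insert \<phi> (\<Delta> - {\<phi>})"]]
    by (intro exI[of _ "\<Delta> - {\<phi>}"]) blast
next
  case (ImpE \<Gamma> \<phi> \<psi>)
  then obtain \<Delta> \<Delta>' where "\<Delta> \<subseteq> \<Gamma>" "finite \<Delta>" "\<Delta> \<turnstile> Imp \<phi> \<psi>" "\<Delta>' \<subseteq> \<Gamma>" "finite \<Delta>'" "\<Delta>' \<turnstile> \<phi>"
    by auto
  then show ?case
    using weaken[of \<Delta> _ "\<Delta> \<union> \<Delta>'"] weaken[of \<Delta>' _ "\<Delta> \<union> \<Delta>'"] provable.ImpE
    by (intro exI[of _ "\<Delta> \<union> \<Delta>'"]) blast
next
  case (Contr \<phi> \<Gamma>)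
  then obtain \<Delta> where "\<Delta> \<subseteq> insert (Neg \<phi>) \<Gamma>" "finite \<Delta>" "\<Delta> \<turnstile> Bot" by auto
  then show ?case
    using provable.Contr[OF weaken[of \<Delta> Bot "insert (Neg \<phi>) (\<Delta> - {Neg \<phi>})"]]
    by (intro exI[of _ "\<Delta> - {Neg \<phi>}"]) blast
next
  case (ForallI \<Gamma> \<phi>)
  then obtain \<Delta> where "\<Delta> \<subseteq> lift ` \<Gamma>" "finite \<Delta>" "\<Delta> \<turnstile> \<phi>" by auto
  then show ?case
    by (metis finite_subset_image provable.ForallI)
next
  case (ForallE \<Gamma> \<phi> t)
  then show ?case by (meson provable.ForallE)
next
  case (EqRefl \<Gamma> t)
  then show ?case by (intro exI[of _ "{}"]) (auto intro: provable.EqRefl)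
next
  case (EqSubst \<Gamma> s t \<phi>)
  then obtain \<Delta> \<Delta>' where "\<Delta> \<subseteq> \<Gamma>" "finite \<Delta>" "\<Delta> \<turnstile> Eq s t" "\<Delta>' \<subseteq> \<Gamma>" "finite \<Delta>'" "\<Delta>' \<turnstile> inst s \<phi>"
    by auto
  then show ?case
    using weaken[of \<Delta> _ "\<Delta> \<union> \<Delta>'"] weaken[of \<Delta>' _ "\<Delta> \<union> \<Delta>'"] provable.EqSubst
    by (intro exI[of _ "\<Delta> \<union> \<Delta>'"]) blast
qed

lemma provable_subst: "\<Gamma> \<turnstile> \<phi> \<Longrightarrow> subst \<sigma> ` \<Gamma> \<turnstile> subst \<sigma> \<phi>"
proof (induction arbitrary: \<sigma> rule: provable.induct)
  case (ForallI \<Gamma> \<phi>)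
  from ForallI.IH[of "under_binder \<sigma>"] have "lift ` subst \<sigma> ` \<Gamma> \<turnstile> subst (under_binder \<sigma>) \<phi>"
    by (simp add: image_image subst_lift)
  then show ?case by (simp add: provable.ForallI)
next
  case (ForallE \<Gamma> \<phi> t)
  from provable.ForallE[OF ForallE.IH[of \<sigma>, simplified]] show ?case by (simp add: subst_inst)
next
  case (EqSubst \<Gamma> s t \<phi>)
  show ?case using EqSubst.IH(1)[of \<sigma>] EqSubst.IH(2)[of \<sigma>]
    by (simp add: subst_inst) (rule provable.EqSubst)
qed (auto intro: provable.intros)

text \<open>
  The rule for the universal quantifier with a named eigenvariable: renaming \<open>k\<close> to index \<open>0\<close> and
  shifting the other indices turns the premise into that of \<open>ForallI\<close>.
\<close>

lemma generalize:
  assumes "\<Gamma> \<turnstile> inst (Var k) \<phi>" "k \<notin> fv (Forall \<phi>)" "\<And>\<psi>. \<psi> \<in> \<Gamma> \<Longrightarrow> k \<notin> fv \<psi>"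
  shows "\<Gamma> \<turnstile> Forall \<phi>"
proof (rule provable.ForallI)
  define \<sigma> where "\<sigma> i = (if i = k then Var 0 else Var (Suc i))" for i
  have "subst \<sigma> ` \<Gamma> = lift ` \<Gamma>"
  proof (rule image_cong)
    fix \<psi> assume "\<psi> \<in> \<Gamma>"
    then show "subst \<sigma> \<psi> = lift \<psi>"
      unfolding lift_def by (intro subst_cong) (auto simp: \<sigma>_def dest: assms(3))
  qed simp
  moreover have "subst \<sigma> (inst (Var k) \<phi>) = subst Var \<phi>"
    unfolding inst_def subst_subst
  proof (rule subst_cong)
    fix i assume "i \<in> fv \<phi>"
    then show "subst_tm \<sigma> (case i of 0 \<Rightarrow> Var k | Suc x \<Rightarrow> Var x) = Var i"
      using assms(2) by (cases i) (auto simp: \<sigma>_def)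
  qed
  ultimately show "lift ` \<Gamma> \<turnstile> \<phi>" using provable_subst[OF assms(1), of \<sigma>] by simp
qed

lemma explode: "\<Gamma> \<turnstile> Bot \<Longrightarrow> \<Gamma> \<turnstile> \<phi>"
  by (rule Contr) (erule weaken, blast)

lemma neg_intro: "insert \<phi> \<Gamma> \<turnstile> Bot \<Longrightarrow> \<Gamma> \<turnstile> Neg \<phi>"
  by (rule ImpI)

lemma cut: "insert \<phi> \<Gamma> \<turnstile> \<psi> \<Longrightarrow> \<Gamma> \<turnstile> \<phi> \<Longrightarrow> \<Gamma> \<turnstile> \<psi>"
  by (meson ImpI ImpE)

section \<open>Structures and soundness\<close>

text \<open>
  Structures have a carrier \<open>univ\<close> because the term model below is a quotient: its elements are
  chosen representatives of classes of terms.
\<close>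

record 'a model =
  univ :: "'a set"
  zero :: "'a"
  succ :: "'a \<Rightarrow> 'a"
  plus :: "'a \<Rightarrow> 'a \<Rightarrow> 'a"
  times :: "'a \<Rightarrow> 'a \<Rightarrow> 'a"
  leq :: "'a \<Rightarrow> 'a \<Rightarrow> bool"

definition wf_model :: "'a model \<Rightarrow> bool" where
  "wf_model M \<longleftrightarrow> zero M \<in> univ M \<and> (\<forall>a\<in>univ M. succ M a \<in> univ M) \<and>
     (\<forall>a\<in>univ M. \<forall>b\<in>univ M. plus M a b \<in> univ M \<and> times M a b \<in> univ M)"

definition envs :: "'a model \<Rightarrow> (nat \<Rightarrow> 'a) set" where
  "envs M = {e. \<forall>i. e i \<in> univ M}"

primrec mval :: "'a model \<Rightarrow> (nat \<Rightarrow> 'a) \<Rightarrow> tm \<Rightarrow> 'a" where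
  "mval M e (Var i) = e i"
| "mval M e Zero = zero M"
| "mval M e (Sc t) = succ M (mval M e t)"
| "mval M e (Add s t) = plus M (mval M e s) (mval M e t)"
| "mval M e (Mul s t) = times M (mval M e s) (mval M e t)"

primrec msat :: "'a model \<Rightarrow> (nat \<Rightarrow> 'a) \<Rightarrow> fm \<Rightarrow> bool" where
  "msat M e (Eq s t) \<longleftrightarrow> mval M e s = mval M e t"
| "msat M e (Le s t) \<longleftrightarrow> leq M (mval M e s) (mval M e t)"
| "msat M e Bot \<longleftrightarrow> False"
| "msat M e (Imp \<phi> \<psi>) \<longleftrightarrow> (msat M e \<phi> \<longrightarrow> msat M e \<psi>)"
| "msat M e (Forall \<phi>) \<longleftrightarrow> (\<forall>a\<in>univ M. msat M (case_nat a e) \<phi>)"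

lemma envs_nth: "e \<in> envs M \<Longrightarrow> e i \<in> univ M"
  by (simp add: envs_def)

lemma envs_case_nat [simp]: "a \<in> univ M \<Longrightarrow> e \<in> envs M \<Longrightarrow> case_nat a e \<in> envs M"
  by (auto simp: envs_def split: nat.split)

lemma mval_in_univ [simp]: "wf_model M \<Longrightarrow> e \<in> envs M \<Longrightarrow> mval M e t \<in> univ M"
  by (induction t) (auto simp: wf_model_def envs_nth)

lemma envs_mval [simp]: "wf_model M \<Longrightarrow> e \<in> envs M \<Longrightarrow> (\<lambda>i. mval M e (\<sigma> i)) \<in> envs M"
  using mval_in_univ[of M e] by (simp add: envs_def)

lemma mval_subst_tm: "mval M e (subst_tm \<sigma> t) = mval M (\<lambda>i. mval M e (\<sigma> i)) t"
  by (induction t) auto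

lemma mval_lift_tm [simp]: "mval M (case_nat a e) (lift_tm t) = mval M e t"
  by (simp add: lift_tm_def mval_subst_tm)

lemma msat_subst: "msat M e (subst \<sigma> \<phi>) \<longleftrightarrow> msat M (\<lambda>i. mval M e (\<sigma> i)) \<phi>"
proof (induction \<phi> arbitrary: e \<sigma>)
  case (Forall \<phi>)
  have "(\<lambda>i. mval M (case_nat a e) (under_binder \<sigma> i)) = case_nat a (\<lambda>i. mval M e (\<sigma> i))" for a
    by (rule ext, case_tac i) auto
  then show ?case by (simp add: Forall)
qed (auto simp: mval_subst_tm)

lemma msat_lift [simp]: "msat M (case_nat a e) (lift \<phi>) \<longleftrightarrow> msat M e \<phi>"
  by (simp add: lift_def msat_subst)

lemma msat_inst: "msat M e (inst t \<phi>) \<longleftrightarrow> msat M (case_nat (mval M e t) e) \<phi>"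
proof -
  have "(\<lambda>i. mval M e (case_nat t Var i)) = case_nat (mval M e t) e"
    by (rule ext, case_tac i) auto
  then show ?thesis by (simp add: inst_def msat_subst)
qed

lemma mval_cong: "(\<And>i. i \<in> fv_tm t \<Longrightarrow> e i = e' i) \<Longrightarrow> mval M e t = mval M e' t"
  by (induction t) auto

lemma msat_cong: "(\<And>i. i \<in> fv \<phi> \<Longrightarrow> e i = e' i) \<Longrightarrow> msat M e \<phi> \<longleftrightarrow> msat M e' \<phi>"
proof (induction \<phi> arbitrary: e e')
  case (Eq s t)
  then have "mval M e s = mval M e' s" "mval M e t = mval M e' t" by (auto intro!: mval_cong)
  then show ?case by simp
next
  case (Le s t)
  then have "mval M e s = mval M e' s" "mval M e t = mval M e' t" by (auto intro!: mval_cong)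
  then show ?case by simp
next
  case (Imp \<phi> \<psi>)
  have "msat M e \<phi> = msat M e' \<phi>" using Imp.prems by (intro Imp.IH) auto
  moreover have "msat M e \<psi> = msat M e' \<psi>" using Imp.prems by (intro Imp.IH) auto
  ultimately show ?case by simp
next
  case (Forall \<phi>)
  have "msat M (case_nat a e) \<phi> = msat M (case_nat a e') \<phi>" for a
  proof (rule Forall.IH)
    fix i assume "i \<in> fv \<phi>"
    then show "case_nat a e i = case_nat a e' i"
      by (cases i) (auto simp: Forall.prems)
  qed
  then show ?case by simp
qed simp

lemma msat_sentence: "sentence \<phi> \<Longrightarrow> msat M e \<phi> \<longleftrightarrow> msat M e' \<phi>"
  by (rule msat_cong) (simp add: sentence_def)

definition nat_model :: "nat model" where
  "nat_model = \<lparr>univ = UNIV, zero = 0, succ = Suc, plus = (+), times = (*), leq = (\<le>)\<rparr>"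

lemma nat_model_simps [simp]:
  "univ nat_model = UNIV" "zero nat_model = 0" "succ nat_model = Suc"
  "plus nat_model = (+)" "times nat_model = (*)" "leq nat_model = (\<le>)"
  by (simp_all add: nat_model_def)

lemma mval_nat_model [simp]: "mval nat_model e t = val e t"
  by (induction t) auto

lemma msat_nat_model [simp]: "msat nat_model e \<phi> \<longleftrightarrow> sat e \<phi>"
  by (induction \<phi> arbitrary: e) auto

lemma val_subst_tm: "val e (subst_tm \<sigma> t) = val (\<lambda>i. val e (\<sigma> i)) t"
  using mval_subst_tm[of nat_model e \<sigma> t] by simp

lemma val_lift_tm [simp]: "val (case_nat k e) (lift_tm t) = val e t"
  by (simp add: lift_tm_def val_subst_tm)

lemma sat_subst: "sat e (subst \<sigma> \<phi>) \<longleftrightarrow> sat (\<lambda>i. val e (\<sigma> i)) \<phi>"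
  using msat_subst[of nat_model e \<sigma> \<phi>] by simp

lemma sat_sentence: "sentence \<phi> \<Longrightarrow> sat e \<phi> \<longleftrightarrow> true_in_N \<phi>"
  using msat_sentence[of \<phi> nat_model e] by (auto simp: true_in_N_def)

theorem soundness:
  "\<Gamma> \<turnstile> \<phi> \<Longrightarrow> wf_model M \<Longrightarrow> e \<in> envs M \<Longrightarrow> (\<And>\<psi>. \<psi> \<in> \<Gamma> \<Longrightarrow> msat M e \<psi>) \<Longrightarrow> msat M e \<phi>"
proof (induction arbitrary: e rule: provable.induct)
  case (Contr \<phi> \<Gamma>) then show ?case by (metis insert_iff msat.simps(3,4))
next
  case (ForallI \<Gamma> \<phi>)
  have "msat M (case_nat a e) \<phi>" if "a \<in> univ M" for a
    using that ForallI.prems by (intro ForallI.IH) auto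
  then show ?case by simp
next
  case (EqSubst \<Gamma> s t \<phi>)
  from EqSubst.IH(1)[OF EqSubst.prems] EqSubst.IH(2)[OF EqSubst.prems]
  show ?case by (simp add: msat_inst)
qed (auto simp: msat_inst)

section \<open>Completeness\<close>

instance tm :: countable by countable_datatype
instance fm :: countable by countable_datatype

definition consistent :: "fm set \<Rightarrow> bool" where
  "consistent \<Gamma> \<longleftrightarrow> \<not> \<Gamma> \<turnstile> Bot"

text \<open>
  The reason is generalization: if \<open>\<not> \<psi>(k)\<close> were refutable, then \<open>\<psi>(k)\<close> would be derivable for an
  arbitrary \<open>k\<close>, against the consistency of \<open>\<not> \<forall>\<psi>\<close>.
\<close>

lemma henkin_witness:
  assumes "consistent (insert (Neg (Forall \<psi>)) \<Gamma>)"
    and "k \<notin> fv (Forall \<psi>)" "\<And>\<chi>. \<chi> \<in> \<Gamma> \<Longrightarrow> k \<notin> fv \<chi>"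
  shows "consistent (insert (Neg (inst (Var k) \<psi>)) (insert (Neg (Forall \<psi>)) \<Gamma>))"
proof (rule ccontr)
  let ?\<Delta> = "insert (Neg (Forall \<psi>)) \<Gamma>"
  assume "\<not> ?thesis"
  then have "?\<Delta> \<turnstile> inst (Var k) \<psi>" by (simp add: consistent_def Contr)
  then have "?\<Delta> \<turnstile> Forall \<psi>" by (rule generalize) (use assms(2,3) in auto)
  moreover have "?\<Delta> \<turnstile> Neg (Forall \<psi>)" by (rule Hyp) simp
  ultimately have "?\<Delta> \<turnstile> Bot" by (rule ImpE[rotated])
  with assms(1) show False by (simp add: consistent_def)
qed

definition fresh :: "fm set \<Rightarrow> nat" where
  "fresh \<Delta> = (SOME k. \<forall>\<chi>\<in>\<Delta>. k \<notin> fv \<chi>)"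

lemma fresh: "finite \<Delta> \<Longrightarrow> \<chi> \<in> \<Delta> \<Longrightarrow> fresh \<Delta> \<notin> fv \<chi>"
proof -
  assume "finite \<Delta>" "\<chi> \<in> \<Delta>"
  then have "finite (\<Union>(fv ` \<Delta>))" by simp
  then obtain k where "k \<notin> \<Union>(fv ` \<Delta>)" using ex_new_if_finite[OF infinite_UNIV_nat] by blast
  then have "\<exists>k. \<forall>\<chi>\<in>\<Delta>. k \<notin> fv \<chi>" by auto
  from someI_ex[OF this] show ?thesis using \<open>\<chi> \<in> \<Delta>\<close> by (simp add: fresh_def)
qed

text \<open>
  At most one formula, present when \<open>\<chi>\<close> is a negated universal formula.
\<close>

definition witnesses :: "fm set \<Rightarrow> fm \<Rightarrow> fm set" where
  "witnesses \<Delta> \<chi> = {Neg (inst (Var (fresh (insert \<chi> \<Delta>))) \<psi>) |\<psi>. \<chi> = Neg (Forall \<psi>)}"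

text \<open>
  Lindenbaum's construction along an enumeration of the formulas, with Henkin witnesses added at
  once. The theory \<open>\<Gamma>\<close> consists of sentences and each stage is finite, so variables serve as witness
  constants: all but finitely many are still fresh.
\<close>

primrec stage :: "fm set \<Rightarrow> fm \<Rightarrow> nat \<Rightarrow> fm set" where
  "stage \<Gamma> \<phi> 0 = {Neg \<phi>}"
| "stage \<Gamma> \<phi> (Suc n) =
    (let \<Delta> = stage \<Gamma> \<phi> n; \<chi> = from_nat n in
      if consistent (\<Gamma> \<union> insert \<chi> \<Delta>) then insert \<chi> (witnesses \<Delta> \<chi> \<union> \<Delta>) else \<Delta>)"

definition henkin :: "fm set \<Rightarrow> fm \<Rightarrow> fm set" where
  "henkin \<Gamma> \<phi> = \<Gamma> \<union> (\<Union>n. stage \<Gamma> \<phi> n)"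

lemma finite_witnesses: "finite (witnesses \<Delta> \<chi>)"
  by (cases "\<exists>\<psi>. \<chi> = Neg (Forall \<psi>)") (auto simp: witnesses_def)

lemma finite_stage: "finite (stage \<Gamma> \<phi> n)"
  by (induction n) (auto simp: Let_def finite_witnesses)

lemma consistent_stage:
  assumes "\<not> \<Gamma> \<turnstile> \<phi>" "\<forall>\<chi>\<in>\<Gamma>. sentence \<chi>"
  shows "consistent (\<Gamma> \<union> stage \<Gamma> \<phi> n)"
proof (induction n)
  case 0
  then show ?case using assms(1) Contr by (auto simp: consistent_def)
next
  case (Suc n)
  let ?\<Delta> = "stage \<Gamma> \<phi> n" and ?\<chi> = "from_nat n :: fm"
  show ?case
  proof (cases "consistent (\<Gamma> \<union> insert ?\<chi> ?\<Delta>)")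
    case True
    have "consistent (\<Gamma> \<union> insert ?\<chi> (witnesses ?\<Delta> ?\<chi> \<union> ?\<Delta>))"
    proof (cases "\<exists>\<psi>. ?\<chi> = Neg (Forall \<psi>)")
      case True': True
      then obtain \<psi> where \<psi>: "?\<chi> = Neg (Forall \<psi>)" by blast
      let ?k = "fresh (insert ?\<chi> ?\<Delta>)"
      have k: "?k \<notin> fv \<chi>" if "\<chi> \<in> insert ?\<chi> ?\<Delta>" for \<chi>
        using that by (intro fresh) (simp_all add: finite_stage)
      have "consistent (insert (Neg (inst (Var ?k) \<psi>)) (insert (Neg (Forall \<psi>)) (\<Gamma> \<union> ?\<Delta>)))"
      proof (rule henkin_witness)
        show "consistent (insert (Neg (Forall \<psi>)) (\<Gamma> \<union> ?\<Delta>))" using True \<psi> by simp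
        show "?k \<notin> fv (Forall \<psi>)" using k[of ?\<chi>] \<psi> by simp
        show "?k \<notin> fv \<chi>" if "\<chi> \<in> \<Gamma> \<union> ?\<Delta>" for \<chi>
          using that k[of \<chi>] assms(2) by (auto simp: sentence_def)
      qed
      moreover have "witnesses ?\<Delta> ?\<chi> = {Neg (inst (Var ?k) \<psi>)}" by (simp add: witnesses_def \<psi>)
      ultimately show ?thesis using \<psi> by (simp add: insert_commute)
    next
      case False
      then have "witnesses ?\<Delta> ?\<chi> = {}" by (simp add: witnesses_def)
      with True show ?thesis by simp
    qed
    with True show ?thesis by (simp add: Let_def)
  next
    case False
    with Suc show ?thesis by (simp add: Let_def)
  qed
qed

lemma stage_mono: "m \<le> n \<Longrightarrow> stage \<Gamma> \<phi> m \<subseteq> stage \<Gamma> \<phi> n"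
  by (rule lift_Suc_mono_le[of "stage \<Gamma> \<phi>"]) (auto simp: Let_def)

lemma consistent_henkin:
  assumes "\<not> \<Gamma> \<turnstile> \<phi>" "\<forall>\<chi>\<in>\<Gamma>. sentence \<chi>"
  shows "consistent (henkin \<Gamma> \<phi>)"
proof (rule ccontr)
  assume "\<not> ?thesis"
  then obtain \<Delta> where \<Delta>: "\<Delta> \<subseteq> henkin \<Gamma> \<phi>" "finite \<Delta>" "\<Delta> \<turnstile> Bot"
    using provable_finite unfolding consistent_def by blast
  have "\<exists>n. \<Delta> \<subseteq> \<Gamma> \<union> stage \<Gamma> \<phi> n"
    using \<Delta>(2,1)
  proof (induction rule: finite_induct)
    case (insert \<chi> \<Delta>)
    then obtain m n where "\<Delta> \<subseteq> \<Gamma> \<union> stage \<Gamma> \<phi> n" "\<chi> \<in> \<Gamma> \<union> stage \<Gamma> \<phi> m"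
      by (auto simp: henkin_def)
    moreover have "stage \<Gamma> \<phi> n \<subseteq> stage \<Gamma> \<phi> (max m n)" "stage \<Gamma> \<phi> m \<subseteq> stage \<Gamma> \<phi> (max m n)"
      by (auto intro!: stage_mono)
    ultimately show ?case by (intro exI[of _ "max m n"]) auto
  qed simp
  with \<Delta>(3) consistent_stage[OF assms] weaken show False
    unfolding consistent_def by blast
qed

lemma henkin_maximal:
  assumes "consistent (insert \<chi> (henkin \<Gamma> \<phi>))"
  shows "\<chi> \<in> henkin \<Gamma> \<phi>" and "\<chi> = Neg (Forall \<psi>) \<Longrightarrow> \<exists>k. Neg (inst (Var k) \<psi>) \<in> henkin \<Gamma> \<phi>"
proof -
  \<comment> \<open>the stage at which \<open>\<chi>\<close> is considered\<close>
  let ?n = "to_nat \<chi>"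
  have "consistent (\<Gamma> \<union> insert \<chi> (stage \<Gamma> \<phi> ?n))"
    using assms weaken[of "\<Gamma> \<union> insert \<chi> (stage \<Gamma> \<phi> ?n)" Bot "insert \<chi> (henkin \<Gamma> \<phi>)"]
    unfolding consistent_def henkin_def by blast
  then have *: "stage \<Gamma> \<phi> (Suc ?n) = insert \<chi> (witnesses (stage \<Gamma> \<phi> ?n) \<chi> \<union> stage \<Gamma> \<phi> ?n)"
    by (simp add: Let_def)
  then have "\<chi> \<in> stage \<Gamma> \<phi> (Suc ?n)" by blast
  then show "\<chi> \<in> henkin \<Gamma> \<phi>" by (auto simp only: henkin_def)
  assume "\<chi> = Neg (Forall \<psi>)"
  then have "\<exists>k. Neg (inst (Var k) \<psi>) \<in> stage \<Gamma> \<phi> (Suc ?n)"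
    unfolding * by (auto simp: witnesses_def)
  then show "\<exists>k. Neg (inst (Var k) \<psi>) \<in> henkin \<Gamma> \<phi>" by (auto simp only: henkin_def)
qed

text \<open>
  The three properties of the limit of the construction from which the term model is built.
\<close>

locale henkin_set =
  fixes H :: "fm set"
  assumes consistent: "consistent H"
    and maximal: "consistent (insert \<chi> H) \<Longrightarrow> \<chi> \<in> H"
    and witness: "Neg (Forall \<psi>) \<in> H \<Longrightarrow> \<exists>k. Neg (inst (Var k) \<psi>) \<in> H"
begin

lemma closed: "H \<turnstile> \<chi> \<Longrightarrow> \<chi> \<in> H"
  using consistent maximal cut unfolding consistent_def by blast

lemma mem_iff: "\<chi> \<in> H \<longleftrightarrow> H \<turnstile> \<chi>"
  using closed Hyp by blast

lemma Bot_notin: "Bot \<notin> H"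
  using consistent Hyp by (auto simp: consistent_def)

lemma Neg_iff: "Neg \<chi> \<in> H \<longleftrightarrow> \<chi> \<notin> H"
proof
  assume "Neg \<chi> \<in> H"
  then show "\<chi> \<notin> H" using consistent ImpE Hyp by (metis consistent_def)
next
  assume "\<chi> \<notin> H"
  then have "insert \<chi> H \<turnstile> Bot" using maximal by (auto simp: consistent_def)
  then show "Neg \<chi> \<in> H" by (intro closed neg_intro)
qed

lemma Imp_iff: "Imp \<chi> \<psi> \<in> H \<longleftrightarrow> (\<chi> \<in> H \<longrightarrow> \<psi> \<in> H)"
proof
  assume "Imp \<chi> \<psi> \<in> H"
  then show "\<chi> \<in> H \<longrightarrow> \<psi> \<in> H" by (meson mem_iff ImpE)
next
  assume *: "\<chi> \<in> H \<longrightarrow> \<psi> \<in> H"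
  show "Imp \<chi> \<psi> \<in> H"
  proof (cases "\<chi> \<in> H")
    case True
    then have "insert \<chi> H \<turnstile> \<psi>" using * by (intro Hyp) simp
    then show ?thesis by (intro closed ImpI)
  next
    case False
    then have "Neg \<chi> \<in> H" by (simp add: Neg_iff)
    then have "insert \<chi> H \<turnstile> Bot" by (meson Hyp ImpE insertI1 insertI2)
    then show ?thesis by (rule closed[OF ImpI[OF explode]])
  qed
qed

lemma Forall_iff: "Forall \<psi> \<in> H \<longleftrightarrow> (\<forall>t. inst t \<psi> \<in> H)"
  using witness[of \<psi>] ForallE by (metis Neg_iff mem_iff)

definition eqv :: "tm \<Rightarrow> tm \<Rightarrow> bool" where "eqv s t \<longleftrightarrow> Eq s t \<in> H"

text \<open>
  Leibniz's rule. The congruence properties below are obtained by replacing one marked occurrence,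
  the variable of index \<open>0\<close>, at a time.
\<close>

lemma eqv_replace:
  assumes "eqv s t" "subst (case_nat s Var) \<psi> \<in> H"
  shows "subst (case_nat t Var) \<psi> \<in> H"
  using assms EqSubst[of H s t \<psi>] by (simp add: eqv_def mem_iff inst_def)

lemma eqv_refl: "eqv t t"
  by (simp add: eqv_def mem_iff EqRefl)

lemma eqv_sym: "eqv s t \<Longrightarrow> eqv t s"
  using eqv_replace[of s t "Eq (Var 0) (lift_tm s)"] eqv_refl[of s] by (simp add: eqv_def)

lemma eqv_trans: "eqv r s \<Longrightarrow> eqv s t \<Longrightarrow> eqv r t"
  using eqv_replace[of s t "Eq (lift_tm r) (Var 0)"] by (simp add: eqv_def)

lemma eqv_Sc: "eqv s t \<Longrightarrow> eqv (Sc s) (Sc t)"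
  using eqv_replace[of s t "Eq (Sc (lift_tm s)) (Sc (Var 0))"] eqv_refl[of "Sc s"]
  by (simp add: eqv_def)

lemma eqv_Add: "eqv s t \<Longrightarrow> eqv s' t' \<Longrightarrow> eqv (Add s s') (Add t t')"
  using eqv_replace[of s t "Eq (Add (lift_tm s) (lift_tm s')) (Add (Var 0) (lift_tm s'))"]
    eqv_replace[of s' t' "Eq (Add (lift_tm s) (lift_tm s')) (Add (lift_tm t) (Var 0))"]
    eqv_refl[of "Add s s'"]
  by (simp add: eqv_def)

lemma eqv_Mul: "eqv s t \<Longrightarrow> eqv s' t' \<Longrightarrow> eqv (Mul s s') (Mul t t')"
  using eqv_replace[of s t "Eq (Mul (lift_tm s) (lift_tm s')) (Mul (Var 0) (lift_tm s'))"]
    eqv_replace[of s' t' "Eq (Mul (lift_tm s) (lift_tm s')) (Mul (lift_tm t) (Var 0))"]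
    eqv_refl[of "Mul s s'"]
  by (simp add: eqv_def)

lemma eqv_Le: "eqv s t \<Longrightarrow> eqv s' t' \<Longrightarrow> Le s s' \<in> H \<Longrightarrow> Le t t' \<in> H"
  using eqv_replace[of s t "Le (Var 0) (lift_tm s')"] eqv_replace[of s' t' "Le (lift_tm t) (Var 0)"]
  by simp

definition rep :: "tm \<Rightarrow> tm" where "rep t = (SOME s. eqv t s)"

lemma eqv_rep: "eqv t (rep t)"
  unfolding rep_def by (rule someI) (rule eqv_refl)

lemma rep_eq_iff: "rep s = rep t \<longleftrightarrow> eqv s t"
proof
  assume "rep s = rep t"
  then show "eqv s t" by (metis eqv_rep eqv_sym eqv_trans)
next
  assume "eqv s t"
  then have "eqv s = eqv t" by (auto intro: eqv_sym eqv_trans)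
  then show "rep s = rep t" by (simp add: rep_def)
qed

definition term_model :: "tm model" where
  "term_model = \<lparr>univ = range rep, zero = rep Zero, succ = (\<lambda>s. rep (Sc s)),
     plus = (\<lambda>s t. rep (Add s t)), times = (\<lambda>s t. rep (Mul s t)), leq = (\<lambda>s t. Le s t \<in> H)\<rparr>"

lemma wf_term_model: "wf_model term_model"
  by (simp add: wf_model_def term_model_def)

lemma mval_term_model: "mval term_model (\<lambda>i. rep (\<sigma> i)) t = rep (subst_tm \<sigma> t)"
proof (induction t)
  case (Sc t)
  then show ?case by (simp add: term_model_def rep_eq_iff) (meson eqv_Sc eqv_rep eqv_sym)
next
  case (Add s t)
  then show ?case by (simp add: term_model_def rep_eq_iff) (meson eqv_Add eqv_rep eqv_sym)
next
  case (Mul s t)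
  then show ?case by (simp add: term_model_def rep_eq_iff) (meson eqv_Mul eqv_rep eqv_sym)
qed (auto simp: term_model_def)

lemma truth: "msat term_model (\<lambda>i. rep (\<sigma> i)) \<chi> \<longleftrightarrow> subst \<sigma> \<chi> \<in> H"
proof (induction \<chi> arbitrary: \<sigma>)
  case (Eq s t)
  then show ?case by (simp add: mval_term_model rep_eq_iff) (simp add: eqv_def)
next
  case (Le s t)
  have "leq term_model a b \<longleftrightarrow> Le a b \<in> H" for a b by (simp add: term_model_def)
  then show ?case by (simp add: mval_term_model) (meson eqv_Le eqv_rep eqv_sym)
next
  case Bot
  then show ?case by (simp add: Bot_notin)
next
  case (Imp \<chi> \<psi>)
  then show ?case by (simp add: Imp_iff)
next
  case (Forall \<chi>)
  have *: "case_nat (rep t) (\<lambda>i. rep (\<sigma> i)) = (\<lambda>i. rep (case_nat t \<sigma> i))" for t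
    by (rule ext, case_tac i) auto
  have "msat term_model (\<lambda>i. rep (\<sigma> i)) (Forall \<chi>) \<longleftrightarrow> (\<forall>t. subst (case_nat t \<sigma>) \<chi> \<in> H)"
    by (simp add: term_model_def[THEN arg_cong[where f = univ]] * Forall)
  then show ?case by (simp add: Forall_iff subst_under_binder_inst)
qed

end

text \<open>
  If \<open>\<phi>\<close> is not derivable, the term model of a Henkin set that contains \<open>\<Gamma>\<close> and \<open>\<not> \<phi>\<close> is a counterexample.
\<close>

theorem completeness:
  assumes "\<forall>\<chi>\<in>\<Gamma>. sentence \<chi>"
    and "\<And>M :: tm model. \<And>e. wf_model M \<Longrightarrow> e \<in> envs M \<Longrightarrow> (\<And>\<psi>. \<psi> \<in> \<Gamma> \<Longrightarrow> msat M e \<psi>) \<Longrightarrow> msat M e \<phi>"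
  shows "\<Gamma> \<turnstile> \<phi>"
proof (rule ccontr)
  assume n: "\<not> \<Gamma> \<turnstile> \<phi>"
  interpret henkin_set "henkin \<Gamma> \<phi>"
  proof
    show "consistent (henkin \<Gamma> \<phi>)" using n assms(1) by (rule consistent_henkin)
    show "\<chi> \<in> henkin \<Gamma> \<phi>" if "consistent (insert \<chi> (henkin \<Gamma> \<phi>))" for \<chi>
      using that by (rule henkin_maximal)
    show "\<exists>k. Neg (inst (Var k) \<psi>) \<in> henkin \<Gamma> \<phi>" if "Neg (Forall \<psi>) \<in> henkin \<Gamma> \<phi>" for \<psi>
      using \<open>consistent (henkin \<Gamma> \<phi>)\<close> that henkin_maximal(2)[OF _ refl]
      by (simp add: insert_absorb)
  qed
  let ?e = "\<lambda>i. rep (Var i)"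
  have truth': "msat term_model ?e \<chi> \<longleftrightarrow> \<chi> \<in> henkin \<Gamma> \<phi>" for \<chi>
    using truth[of Var \<chi>] by simp
  have "msat term_model ?e \<phi>"
  proof (rule assms(2)[OF wf_term_model])
    show "?e \<in> envs term_model" by (simp add: envs_def term_model_def)
    show "msat term_model ?e \<psi>" if "\<psi> \<in> \<Gamma>" for \<psi>
      using that by (simp add: truth') (simp add: henkin_def)
  qed
  moreover have "Neg \<phi> \<in> stage \<Gamma> \<phi> 0" by simp
  then have "Neg \<phi> \<in> henkin \<Gamma> \<phi>" unfolding henkin_def by blast
  ultimately show False by (simp add: truth' Neg_iff)
qed

section \<open>The arithmetical classes up to logical equivalence\<close>

text \<open>
  By completeness this is provability of the biconditional; models with terms as elements suffice.
\<close>

definition equivalent :: "fm \<Rightarrow> fm \<Rightarrow> bool" where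
  "equivalent \<phi> \<psi> \<longleftrightarrow>
     (\<forall>M :: tm model. \<forall>e. wf_model M \<longrightarrow> e \<in> envs M \<longrightarrow> msat M e \<phi> = msat M e \<psi>)"

lemma provable_Iff: "{} \<turnstile> Iff \<phi> \<psi> \<longleftrightarrow> equivalent \<phi> \<psi>"
proof
  assume "{} \<turnstile> Iff \<phi> \<psi>"
  then show "equivalent \<phi> \<psi>"
    unfolding equivalent_def by (metis soundness empty_iff msat.simps(3,4))
next
  assume "equivalent \<phi> \<psi>"
  then show "{} \<turnstile> Iff \<phi> \<psi>"
    by (intro completeness) (auto simp: equivalent_def)
qed

lemma Sigma_class_iff: "\<phi> \<in> Sigma_class n \<longleftrightarrow> (\<exists>\<psi>\<in>sigma_prenex n. equivalent \<phi> \<psi>)"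
  and Pi_class_iff: "\<phi> \<in> Pi_class n \<longleftrightarrow> (\<exists>\<psi>\<in>pi_prenex n. equivalent \<phi> \<psi>)"
  by (auto simp: Sigma_class_def Pi_class_def provable_Iff)

lemma equivalent_refl [simp]: "equivalent \<phi> \<phi>"
  and equivalent_sym: "equivalent \<phi> \<psi> \<Longrightarrow> equivalent \<psi> \<phi>"
  and equivalent_trans: "equivalent \<phi> \<psi> \<Longrightarrow> equivalent \<psi> \<chi> \<Longrightarrow> equivalent \<phi> \<chi>"
  by (auto simp: equivalent_def)

lemma equivalent_Imp:
  "equivalent \<phi> \<phi>' \<Longrightarrow> equivalent \<psi> \<psi>' \<Longrightarrow> equivalent (Imp \<phi> \<psi>) (Imp \<phi>' \<psi>')"
  by (auto simp: equivalent_def)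

lemma equivalent_Forall: "equivalent \<phi> \<phi>' \<Longrightarrow> equivalent (Forall \<phi>) (Forall \<phi>')"
  by (auto simp: equivalent_def)

lemma equivalent_Exists: "equivalent \<phi> \<phi>' \<Longrightarrow> equivalent (Exists \<phi>) (Exists \<phi>')"
  by (auto simp: equivalent_def)

lemma equivalent_subst: "equivalent \<phi> \<phi>' \<Longrightarrow> equivalent (subst \<sigma> \<phi>) (subst \<sigma> \<phi>')"
  by (auto simp: equivalent_def msat_subst)

lemma Sigma_class_equivalent: "\<phi> \<in> Sigma_class n \<Longrightarrow> equivalent \<phi> \<psi> \<Longrightarrow> \<psi> \<in> Sigma_class n"
  and Pi_class_equivalent: "\<phi> \<in> Pi_class n \<Longrightarrow> equivalent \<phi> \<psi> \<Longrightarrow> \<psi> \<in> Pi_class n"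
  unfolding Sigma_class_iff Pi_class_iff by (meson equivalent_sym equivalent_trans)+

lemma Pi_class_0: "Pi_class 0 = Sigma_class 0"
  by (auto simp: Sigma_class_iff Pi_class_iff)

lemma funpow_Exists_Neg: "equivalent (Neg ((Exists ^^ k) \<phi>)) ((Forall ^^ k) (Neg \<phi>))"
proof (induction k)
  case (Suc k)
  then show ?case by (auto simp: equivalent_def)
qed simp

lemma funpow_Forall_Neg: "equivalent (Neg ((Forall ^^ k) \<phi>)) ((Exists ^^ k) (Neg \<phi>))"
proof (induction k)
  case (Suc k)
  then show ?case by (auto simp: equivalent_def)
qed simp

lemma equivalent_funpow_Exists: "equivalent \<phi> \<psi> \<Longrightarrow> equivalent ((Exists ^^ k) \<phi>) ((Exists ^^ k) \<psi>)"
proof (induction k)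
  case (Suc k) then show ?case by (auto intro!: equivalent_Exists)
qed simp

lemma equivalent_funpow_Forall: "equivalent \<phi> \<psi> \<Longrightarrow> equivalent ((Forall ^^ k) \<phi>) ((Forall ^^ k) \<psi>)"
proof (induction k)
  case (Suc k) then show ?case by (auto intro!: equivalent_Forall)
qed simp

lemma Sigma_class_Suc: "\<phi> \<in> Sigma_class (Suc n) \<longleftrightarrow> (\<exists>k. \<exists>\<psi>\<in>Pi_class n. equivalent \<phi> ((Exists ^^ k) \<psi>))"
proof
  assume "\<phi> \<in> Sigma_class (Suc n)"
  then obtain k \<psi> where "\<psi> \<in> pi_prenex n" "equivalent \<phi> ((Exists ^^ k) \<psi>)"
    by (auto simp: Sigma_class_iff)
  moreover from this(1) have "\<psi> \<in> Pi_class n"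
    unfolding Pi_class_iff using equivalent_refl by blast
  ultimately show "\<exists>k. \<exists>\<psi>\<in>Pi_class n. equivalent \<phi> ((Exists ^^ k) \<psi>)" by blast
next
  assume "\<exists>k. \<exists>\<psi>\<in>Pi_class n. equivalent \<phi> ((Exists ^^ k) \<psi>)"
  then obtain k \<psi> \<chi> where "equivalent \<phi> ((Exists ^^ k) \<psi>)" "\<chi> \<in> pi_prenex n" "equivalent \<psi> \<chi>"
    by (auto simp: Pi_class_iff)
  then have "equivalent \<phi> ((Exists ^^ k) \<chi>)" "(Exists ^^ k) \<chi> \<in> sigma_prenex (Suc n)"
    using equivalent_funpow_Exists equivalent_trans by (blast, auto)
  then show "\<phi> \<in> Sigma_class (Suc n)" unfolding Sigma_class_iff by blast
qed

lemma Pi_class_Suc: "\<phi> \<in> Pi_class (Suc n) \<longleftrightarrow> (\<exists>k. \<exists>\<psi>\<in>Sigma_class n. equivalent \<phi> ((Forall ^^ k) \<psi>))"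
proof
  assume "\<phi> \<in> Pi_class (Suc n)"
  then obtain k \<psi> where "\<psi> \<in> sigma_prenex n" "equivalent \<phi> ((Forall ^^ k) \<psi>)"
    by (auto simp: Pi_class_iff)
  moreover from this(1) have "\<psi> \<in> Sigma_class n"
    unfolding Sigma_class_iff using equivalent_refl by blast
  ultimately show "\<exists>k. \<exists>\<psi>\<in>Sigma_class n. equivalent \<phi> ((Forall ^^ k) \<psi>)" by blast
next
  assume "\<exists>k. \<exists>\<psi>\<in>Sigma_class n. equivalent \<phi> ((Forall ^^ k) \<psi>)"
  then obtain k \<psi> \<chi> where "equivalent \<phi> ((Forall ^^ k) \<psi>)" "\<chi> \<in> sigma_prenex n" "equivalent \<psi> \<chi>"
    by (auto simp: Sigma_class_iff)
  then have "equivalent \<phi> ((Forall ^^ k) \<chi>)" "(Forall ^^ k) \<chi> \<in> pi_prenex (Suc n)"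
    using equivalent_funpow_Forall equivalent_trans by (blast, auto)
  then show "\<phi> \<in> Pi_class (Suc n)" unfolding Pi_class_iff by blast
qed

lemma Neg_Sigma_Pi: "(\<phi> \<in> Sigma_class n \<longrightarrow> Neg \<phi> \<in> Pi_class n) \<and> (\<phi> \<in> Pi_class n \<longrightarrow> Neg \<phi> \<in> Sigma_class n)"
proof (induction n arbitrary: \<phi>)
  case 0
  have "Neg \<phi> \<in> Sigma_class 0" if "\<phi> \<in> Sigma_class 0"
    using that equivalent_Imp[OF _ equivalent_refl[of Bot], of \<phi>] delta0.intros(3,4)
    unfolding Sigma_class_iff by fastforce
  then show ?case by (simp add: Pi_class_0)
next
  case (Suc n)
  show ?case
  proof (intro conjI impI)
    assume "\<phi> \<in> Sigma_class (Suc n)"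
    then obtain k \<psi> where "\<psi> \<in> Pi_class n" and e: "equivalent \<phi> ((Exists ^^ k) \<psi>)"
      by (auto simp: Sigma_class_Suc)
    then have "Neg \<psi> \<in> Sigma_class n" using Suc by blast
    moreover have "equivalent (Neg \<phi>) ((Forall ^^ k) (Neg \<psi>))"
      using equivalent_trans[OF equivalent_Imp[OF e equivalent_refl] funpow_Exists_Neg] .
    ultimately show "Neg \<phi> \<in> Pi_class (Suc n)" unfolding Pi_class_Suc by blast
  next
    assume "\<phi> \<in> Pi_class (Suc n)"
    then obtain k \<psi> where "\<psi> \<in> Sigma_class n" and e: "equivalent \<phi> ((Forall ^^ k) \<psi>)"
      by (auto simp: Pi_class_Suc)
    then have "Neg \<psi> \<in> Pi_class n" using Suc by blast
    moreover have "equivalent (Neg \<phi>) ((Exists ^^ k) (Neg \<psi>))"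
      using equivalent_trans[OF equivalent_Imp[OF e equivalent_refl] funpow_Forall_Neg] .
    ultimately show "Neg \<phi> \<in> Sigma_class (Suc n)" unfolding Sigma_class_Suc by blast
  qed
qed

lemma Neg_Sigma: "\<phi> \<in> Sigma_class n \<Longrightarrow> Neg \<phi> \<in> Pi_class n"
  and Neg_Pi: "\<phi> \<in> Pi_class n \<Longrightarrow> Neg \<phi> \<in> Sigma_class n"
  using Neg_Sigma_Pi by blast+

lemma Pi_class_iff_Neg: "\<phi> \<in> Pi_class n \<longleftrightarrow> Neg \<phi> \<in> Sigma_class n"
proof
  assume "Neg \<phi> \<in> Sigma_class n"
  then have "Neg (Neg \<phi>) \<in> Pi_class n" by (rule Neg_Sigma)
  then show "\<phi> \<in> Pi_class n" by (rule Pi_class_equivalent) (auto simp: equivalent_def)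
qed (rule Neg_Pi)

lemma Pi_subset_Sigma_Suc: "Pi_class n \<subseteq> Sigma_class (Suc n)"
  and Sigma_subset_Pi_Suc: "Sigma_class n \<subseteq> Pi_class (Suc n)"
  unfolding Sigma_class_Suc[abs_def] Pi_class_Suc[abs_def] subset_iff
  by (metis equivalent_refl funpow_0 Sigma_class_Suc Pi_class_Suc)+

lemma Exists_Sigma_Suc: "\<phi> \<in> Sigma_class (Suc n) \<Longrightarrow> Exists \<phi> \<in> Sigma_class (Suc n)"
proof -
  assume "\<phi> \<in> Sigma_class (Suc n)"
  then obtain k \<psi> where "\<psi> \<in> Pi_class n" "equivalent \<phi> ((Exists ^^ k) \<psi>)"
    by (auto simp: Sigma_class_Suc)
  then have "equivalent (Exists \<phi>) ((Exists ^^ Suc k) \<psi>)"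
    using equivalent_Exists[of \<phi> "(Exists ^^ k) \<psi>"] by simp
  with \<open>\<psi> \<in> Pi_class n\<close> show ?thesis unfolding Sigma_class_Suc by blast
qed

lemma Forall_Pi_Suc: "\<phi> \<in> Pi_class (Suc n) \<Longrightarrow> Forall \<phi> \<in> Pi_class (Suc n)"
proof -
  assume "\<phi> \<in> Pi_class (Suc n)"
  then obtain k \<psi> where "\<psi> \<in> Sigma_class n" "equivalent \<phi> ((Forall ^^ k) \<psi>)"
    by (auto simp: Pi_class_Suc)
  then have "equivalent (Forall \<phi>) ((Forall ^^ Suc k) \<psi>)"
    using equivalent_Forall[of \<phi> "(Forall ^^ k) \<psi>"] by simp
  with \<open>\<psi> \<in> Sigma_class n\<close> show ?thesis unfolding Pi_class_Suc by blast
qed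

lemma Sigma_mono_Suc: "Sigma_class n \<subseteq> Sigma_class (Suc n) \<and> Pi_class n \<subseteq> Pi_class (Suc n)"
proof (induction n)
  case 0
  show ?case using Pi_subset_Sigma_Suc[of 0] Sigma_subset_Pi_Suc[of 0] by (simp add: Pi_class_0)
next
  case (Suc n)
  show ?case
  proof (intro conjI subsetI)
    fix \<phi> assume "\<phi> \<in> Sigma_class (Suc n)"
    then obtain k \<psi> where "\<psi> \<in> Pi_class n" "equivalent \<phi> ((Exists ^^ k) \<psi>)"
      by (auto simp: Sigma_class_Suc)
    moreover from this(1) Suc have "\<psi> \<in> Pi_class (Suc n)" by blast
    ultimately show "\<phi> \<in> Sigma_class (Suc (Suc n))"
      unfolding Sigma_class_Suc[of _ "Suc n"] by blast
  next
    fix \<phi> assume "\<phi> \<in> Pi_class (Suc n)"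
    then obtain k \<psi> where "\<psi> \<in> Sigma_class n" "equivalent \<phi> ((Forall ^^ k) \<psi>)"
      by (auto simp: Pi_class_Suc)
    moreover from this(1) Suc have "\<psi> \<in> Sigma_class (Suc n)" by blast
    ultimately show "\<phi> \<in> Pi_class (Suc (Suc n))"
      unfolding Pi_class_Suc[of _ "Suc n"] by blast
  qed
qed

lemma Sigma_mono: "m \<le> n \<Longrightarrow> Sigma_class m \<subseteq> Sigma_class n"
  by (rule lift_Suc_mono_le[of Sigma_class]) (use Sigma_mono_Suc in blast)+

lemma Pi_mono: "m \<le> n \<Longrightarrow> Pi_class m \<subseteq> Pi_class n"
  by (rule lift_Suc_mono_le[of Pi_class]) (use Sigma_mono_Suc in blast)+

lemma delta0_subst: "\<phi> \<in> delta0 \<Longrightarrow> subst \<sigma> \<phi> \<in> delta0"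
  by (induction arbitrary: \<sigma> rule: delta0.induct)
     (auto simp: lift_tm_subst_tm[symmetric] intro: delta0.intros)

lemma subst_funpow_Exists: "subst \<sigma> ((Exists ^^ k) \<phi>) = (Exists ^^ k) (subst ((under_binder ^^ k) \<sigma>) \<phi>)"
proof (induction k arbitrary: \<sigma>)
  case (Suc k)
  have "(under_binder ^^ Suc k) \<sigma> = (under_binder ^^ k) (under_binder \<sigma>)"
    by (simp only: funpow_Suc_right comp_apply)
  then show ?case by (simp add: Suc del: funpow.simps(2)) (simp add: Suc)
qed simp

lemma Sigma_Pi_subst: "(\<phi> \<in> Sigma_class n \<longrightarrow> subst \<sigma> \<phi> \<in> Sigma_class n) \<and> (\<phi> \<in> Pi_class n \<longrightarrow> subst \<sigma> \<phi> \<in> Pi_class n)"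
proof (induction n arbitrary: \<phi> \<sigma>)
  case 0
  show ?case unfolding Pi_class_0 using equivalent_subst delta0_subst by (simp add: Sigma_class_iff) blast
next
  case (Suc n)
  have S: "subst \<sigma> \<phi> \<in> Sigma_class (Suc n)" if "\<phi> \<in> Sigma_class (Suc n)" for \<phi> \<sigma>
  proof -
    from that obtain k \<psi> where "\<psi> \<in> Pi_class n" and e: "equivalent \<phi> ((Exists ^^ k) \<psi>)"
      by (auto simp: Sigma_class_Suc)
    then have "subst ((under_binder ^^ k) \<sigma>) \<psi> \<in> Pi_class n" using Suc by blast
    with equivalent_subst[OF e, of \<sigma>] show ?thesis
      unfolding Sigma_class_Suc subst_funpow_Exists by blast
  qed
  with S[of "Neg \<phi>" \<sigma>] show ?case by (auto simp: Pi_class_iff_Neg)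
qed

lemma Sigma_subst: "\<phi> \<in> Sigma_class n \<Longrightarrow> subst \<sigma> \<phi> \<in> Sigma_class n"
  using Sigma_Pi_subst by blast

lemma Exists_And_lift: "equivalent (And (Exists \<phi>) \<psi>) (Exists (And \<phi> (lift \<psi>)))"
  by (auto simp: equivalent_def)

lemma Exists_Or_lift: "equivalent (Or (Exists \<phi>) \<psi>) (Exists (Or \<phi> (lift \<psi>)))"
proof -
  have "\<exists>a. a \<in> univ M" if "wf_model M" for M :: "tm model"
    using that by (auto simp: wf_model_def)
  then show ?thesis by (fastforce simp: equivalent_def)
qed

text \<open>
  Conjunction and disjunction are treated uniformly: for a commutative connective \<open>c\<close> out of which an
  existential quantifier can be pulled, closure of \<open>\<Pi>\<^sub>n\<close> under \<open>c\<close> passes to \<open>\<Sigma>\<^bsub>n+1\<^esub>\<close>. The quantifiers of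
  the second argument are pulled out under those of the first.
\<close>

lemma Sigma_Suc_connective:
  assumes cong: "\<And>\<phi> \<phi>' \<psi> \<psi>'. equivalent \<phi> \<phi>' \<Longrightarrow> equivalent \<psi> \<psi>' \<Longrightarrow> equivalent (c \<phi> \<psi>) (c \<phi>' \<psi>')"
    and comm: "\<And>\<phi> \<psi>. equivalent (c \<phi> \<psi>) (c \<psi> \<phi>)"
    and pull: "\<And>\<phi> \<psi>. equivalent (c (Exists \<phi>) \<psi>) (Exists (c \<phi> (lift \<psi>)))"
    and base: "\<And>\<phi> \<psi>. \<phi> \<in> Pi_class n \<Longrightarrow> \<psi> \<in> Pi_class n \<Longrightarrow> c \<phi> \<psi> \<in> Pi_class n"
    and "\<phi> \<in> Sigma_class (Suc n)" "\<psi> \<in> Sigma_class (Suc n)"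
  shows "c \<phi> \<psi> \<in> Sigma_class (Suc n)"
proof -
  have Pi_lift: "lift \<psi> \<in> Pi_class n" if "\<psi> \<in> Pi_class n" for \<psi>
    using that Sigma_Pi_subst by (simp add: lift_def)
  have 1: "c ((Exists ^^ k) \<phi>) \<psi> \<in> Sigma_class (Suc n)" if "\<phi> \<in> Pi_class n" "\<psi> \<in> Pi_class n" for k \<phi> \<psi>
    using that
  proof (induction k arbitrary: \<psi>)
    case 0
    then show ?case using base Pi_subset_Sigma_Suc by auto
  next
    case (Suc k)
    then have "Exists (c ((Exists ^^ k) \<phi>) (lift \<psi>)) \<in> Sigma_class (Suc n)"
      using Pi_lift by (intro Exists_Sigma_Suc) blast
    from Sigma_class_equivalent[OF this equivalent_sym[OF pull]] show ?case by simp
  qed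
  have 2: "c ((Exists ^^ k) \<phi>) \<psi> \<in> Sigma_class (Suc n)"
    if "\<phi> \<in> Pi_class n" "\<psi> \<in> Sigma_class (Suc n)" for k \<phi> \<psi>
    using that
  proof (induction k arbitrary: \<psi>)
    case 0
    then obtain l \<chi> where "\<chi> \<in> Pi_class n" "equivalent \<psi> ((Exists ^^ l) \<chi>)"
      by (auto simp: Sigma_class_Suc)
    with 0 1[of \<chi> \<phi> l] show ?case
      by (simp del: funpow.simps)
         (meson Sigma_class_equivalent comm cong equivalent_refl equivalent_sym)
  next
    case (Suc k)
    then have "Exists (c ((Exists ^^ k) \<phi>) (lift \<psi>)) \<in> Sigma_class (Suc n)"
      using Sigma_subst by (intro Exists_Sigma_Suc) (simp add: lift_def)
    from Sigma_class_equivalent[OF this equivalent_sym[OF pull]] show ?case by simp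
  qed
  from assms(5) obtain k \<chi> where "\<chi> \<in> Pi_class n" "equivalent \<phi> ((Exists ^^ k) \<chi>)"
    by (auto simp: Sigma_class_Suc)
  with 2[of \<chi> \<psi> k] assms(6) show ?thesis
    by (meson Sigma_class_equivalent cong equivalent_refl equivalent_sym)
qed

text \<open>
  Closure of \<open>\<Pi>\<^sub>n\<close> under one connective is, by duality, closure of \<open>\<Sigma>\<^sub>n\<close> under the other one, so both
  connectives go through the induction together.
\<close>

lemma Sigma_And_Or: "\<phi> \<in> Sigma_class n \<Longrightarrow> \<psi> \<in> Sigma_class n \<Longrightarrow> And \<phi> \<psi> \<in> Sigma_class n \<and> Or \<phi> \<psi> \<in> Sigma_class n"
proof (induction n arbitrary: \<phi> \<psi>)
  case 0
  then obtain \<phi>' \<psi>' where "\<phi>' \<in> delta0" "\<psi>' \<in> delta0" "equivalent \<phi> \<phi>'" "equivalent \<psi> \<psi>'"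
    by (auto simp: Sigma_class_iff)
  moreover from this have "And \<phi>' \<psi>' \<in> delta0" "Or \<phi>' \<psi>' \<in> delta0"
    by (auto intro!: delta0.intros(3,4))
  ultimately show ?case unfolding Sigma_class_iff sigma_prenex.simps
    by (metis equivalent_Imp equivalent_refl)
next
  case (Suc n)
  have Pi: "And \<phi> \<psi> \<in> Pi_class n" "Or \<phi> \<psi> \<in> Pi_class n" if "\<phi> \<in> Pi_class n" "\<psi> \<in> Pi_class n" for \<phi> \<psi>
  proof -
    have "Neg \<phi> \<in> Sigma_class n" "Neg \<psi> \<in> Sigma_class n" using that by (auto intro: Neg_Pi)
    from Suc.IH[OF this]
    have *: "Or (Neg \<phi>) (Neg \<psi>) \<in> Sigma_class n" "And (Neg \<phi>) (Neg \<psi>) \<in> Sigma_class n" by auto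
    show "And \<phi> \<psi> \<in> Pi_class n"
      using * unfolding Pi_class_iff_Neg by (rule_tac Sigma_class_equivalent) (auto simp: equivalent_def)
    show "Or \<phi> \<psi> \<in> Pi_class n"
      using *(2) unfolding Pi_class_iff_Neg by (rule Sigma_class_equivalent) (auto simp: equivalent_def)
  qed
  show ?case
  proof
    show "And \<phi> \<psi> \<in> Sigma_class (Suc n)"
    proof (rule Sigma_Suc_connective[of And])
      show "equivalent (And \<phi> \<psi>) (And \<psi> \<phi>)" for \<phi> \<psi> by (auto simp: equivalent_def)
    qed (simp_all only: Suc.prems Pi Exists_And_lift equivalent_Imp equivalent_refl)
    show "Or \<phi> \<psi> \<in> Sigma_class (Suc n)"
    proof (rule Sigma_Suc_connective[of Or])
      show "equivalent (Or \<phi> \<psi>) (Or \<psi> \<phi>)" for \<phi> \<psi> by (auto simp: equivalent_def)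
    qed (simp_all only: Suc.prems Pi Exists_Or_lift equivalent_Imp equivalent_refl)
  qed
qed

lemma Sigma_And: "\<phi> \<in> Sigma_class n \<Longrightarrow> \<psi> \<in> Sigma_class n \<Longrightarrow> And \<phi> \<psi> \<in> Sigma_class n"
  and Sigma_Or: "\<phi> \<in> Sigma_class n \<Longrightarrow> \<psi> \<in> Sigma_class n \<Longrightarrow> Or \<phi> \<psi> \<in> Sigma_class n"
  using Sigma_And_Or by blast+

lemma Pi_And: "\<phi> \<in> Pi_class n \<Longrightarrow> \<psi> \<in> Pi_class n \<Longrightarrow> And \<phi> \<psi> \<in> Pi_class n"
  unfolding Pi_class_iff_Neg
  using Sigma_Or[of "Neg \<phi>" n "Neg \<psi>"]
  by (rule_tac Sigma_class_equivalent[of "Or (Neg \<phi>) (Neg \<psi>)"]) (auto simp: equivalent_def)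

lemma Pi_Or: "\<phi> \<in> Pi_class n \<Longrightarrow> \<psi> \<in> Pi_class n \<Longrightarrow> Or \<phi> \<psi> \<in> Pi_class n"
  unfolding Pi_class_iff_Neg
  using Sigma_And[of "Neg \<phi>" n "Neg \<psi>"]
  by (rule_tac Sigma_class_equivalent[of "And (Neg \<phi>) (Neg \<psi>)"]) (auto simp: equivalent_def)

section \<open>Models of Robinson arithmetic\<close>

definition num :: "'a model \<Rightarrow> nat \<Rightarrow> 'a" where
  "num M k = (succ M ^^ k) (zero M)"

lemma num_simps [simp]: "num M 0 = zero M" "num M (Suc k) = succ M (num M k)"
  by (auto simp: num_def)

lemma mval_numeral [simp]: "mval M e (numeral_tm k) = num M k"
  by (induction k) (auto simp: numeral_tm_def)

locale Q_model =
  fixes M :: "'a model"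
  assumes wf: "wf_model M"
    and succ_nonzero: "a \<in> univ M \<Longrightarrow> succ M a \<noteq> zero M"
    and succ_inj: "a \<in> univ M \<Longrightarrow> b \<in> univ M \<Longrightarrow> succ M a = succ M b \<Longrightarrow> a = b"
    and predecessor: "a \<in> univ M \<Longrightarrow> a \<noteq> zero M \<Longrightarrow> \<exists>b\<in>univ M. a = succ M b"
    and plus_zero: "a \<in> univ M \<Longrightarrow> plus M a (zero M) = a"
    and plus_succ: "a \<in> univ M \<Longrightarrow> b \<in> univ M \<Longrightarrow> plus M a (succ M b) = succ M (plus M a b)"
    and times_zero: "a \<in> univ M \<Longrightarrow> times M a (zero M) = zero M"
    and times_succ: "a \<in> univ M \<Longrightarrow> b \<in> univ M \<Longrightarrow> times M a (succ M b) = plus M (times M a b) a"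
    and leq_iff: "a \<in> univ M \<Longrightarrow> b \<in> univ M \<Longrightarrow> leq M a b \<longleftrightarrow> (\<exists>c\<in>univ M. plus M c a = b)"
begin

lemma closed [simp]:
  "zero M \<in> univ M" "a \<in> univ M \<Longrightarrow> succ M a \<in> univ M"
  "a \<in> univ M \<Longrightarrow> b \<in> univ M \<Longrightarrow> plus M a b \<in> univ M"
  "a \<in> univ M \<Longrightarrow> b \<in> univ M \<Longrightarrow> times M a b \<in> univ M"
  using wf by (auto simp: wf_model_def)

lemma num_closed [simp]: "num M k \<in> univ M"
  by (induction k) auto

lemma num_plus: "plus M (num M j) (num M k) = num M (j + k)"
  by (induction k) (auto simp: plus_zero plus_succ)

lemma num_times: "times M (num M j) (num M k) = num M (j * k)"
  by (induction k) (auto simp: times_zero times_succ num_plus add.commute)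

lemma num_eq_iff: "num M j = num M k \<longleftrightarrow> j = k"
proof (induction j arbitrary: k)
  case 0
  show ?case by (cases k) (simp_all add: succ_nonzero[OF num_closed, THEN not_sym])
next
  case (Suc j)
  show ?case
  proof (cases k)
    case 0
    then show ?thesis using succ_nonzero[OF num_closed, of j] by simp
  next
    case k: (Suc k')
    show ?thesis using succ_inj[of "num M j" "num M k'"] Suc[of k'] by (auto simp: k)
  qed
qed

text \<open>
  The initial segment property. Adding a successor on the right is a successor, so from
  \<open>c + a = k + 1\<close> with \<open>a\<close> nonzero one may remove a successor from \<open>a\<close> and from \<open>k + 1\<close>.
\<close>

lemma below_num: "a \<in> univ M \<Longrightarrow> leq M a (num M k) \<Longrightarrow> \<exists>j\<le>k. a = num M j"
proof (induction k arbitrary: a)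
  case 0
  show ?case
  proof (cases "a = zero M")
    case False
    then obtain b where b: "b \<in> univ M" "a = succ M b" using predecessor 0 by blast
    then show ?thesis using 0 succ_nonzero by (auto simp: leq_iff plus_succ)
  qed auto
next
  case (Suc k)
  show ?case
  proof (cases "a = zero M")
    case True
    then show ?thesis by (intro exI[of _ 0]) simp
  next
    case False
    then obtain b where b: "b \<in> univ M" "a = succ M b" using predecessor Suc by blast
    from Suc.prems obtain c where "c \<in> univ M" "plus M c a = succ M (num M k)"
      by (auto simp: leq_iff)
    then have "plus M c b = num M k" using b by (auto simp: plus_succ intro: succ_inj)
    then have "leq M b (num M k)" using b \<open>c \<in> univ M\<close> by (auto simp: leq_iff)
    then obtain j where "j \<le> k" "b = num M j" using Suc.IH b by blast
    then show ?thesis using b by (intro exI[of _ "Suc j"]) simp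
  qed
qed

lemma num_leq: "leq M (num M j) (num M k) \<longleftrightarrow> j \<le> k"
proof
  assume "leq M (num M j) (num M k)"
  then show "j \<le> k" using below_num[OF num_closed] num_eq_iff by metis
next
  assume "j \<le> k"
  then show "leq M (num M j) (num M k)"
    by (auto simp: leq_iff intro!: bexI[of _ "num M (k - j)"] simp: num_plus)
qed

text \<open>
  \<open>Q\<close> does not prove that its order is linear, but every element is comparable with every numeral.
\<close>

lemma num_linear: "a \<in> univ M \<Longrightarrow> leq M a (num M k) \<or> leq M (num M k) a"
proof (induction k arbitrary: a)
  case 0
  then have "leq M (zero M) a" by (auto simp: leq_iff plus_zero)
  then show ?case by simp
next
  case (Suc k)
  show ?case
  proof (cases "a = zero M")
    case True
    then show ?thesis using num_leq[of 0 "Suc k"] by simp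
  next
    case False
    then obtain b where b: "b \<in> univ M" "a = succ M b" using predecessor Suc.prems by blast
    from Suc.IH[OF b(1)] show ?thesis
    proof
      assume "leq M b (num M k)"
      then obtain j where "j \<le> k" "b = num M j" using below_num b(1) by blast
      then show ?thesis using num_leq[of "Suc j" "Suc k"] b by simp
    next
      assume "leq M (num M k) b"
      then show ?thesis using b by (auto simp: leq_iff plus_succ)
    qed
  qed
qed

lemma mval_num: "mval M (\<lambda>i. num M (e i)) t = num M (val e t)"
  by (induction t) (auto simp: num_plus num_times)

lemma case_nat_num: "case_nat (num M k) (\<lambda>i. num M (e i)) = (\<lambda>i. num M (case_nat k e i))"
  by (auto split: nat.split)

lemma bounded_num:
  "(\<forall>a\<in>univ M. leq M a (num M k) \<longrightarrow> P a) \<longleftrightarrow> (\<forall>j\<le>k. P (num M j))"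
  using below_num num_leq num_closed by blast

text \<open>
  Elements below a numeral are numerals, so a bounded quantifier has the same range in \<open>M\<close> as in the
  standard model.
\<close>

lemma delta0_absolute: "\<phi> \<in> delta0 \<Longrightarrow> msat M (\<lambda>i. num M (e i)) \<phi> \<longleftrightarrow> sat e \<phi>"
proof (induction arbitrary: e rule: delta0.induct)
  case (5 \<phi> t)
  then show ?case
    using bounded_num[of "val e t" "\<lambda>a. msat M (case_nat a (\<lambda>i. num M (e i))) \<phi>"]
    by (simp add: mval_num case_nat_num val_lift_tm)
next
  case (6 \<phi> t)
  then show ?case
    using bounded_num[of "val e t" "\<lambda>a. \<not> msat M (case_nat a (\<lambda>i. num M (e i))) \<phi>"]
    by (simp add: mval_num case_nat_num val_lift_tm)
qed (auto simp: mval_num num_eq_iff num_leq)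

end

lemma Q_model_if_sat:
  assumes "wf_model M" "e \<in> envs M" "\<And>\<phi>. \<phi> \<in> robinson_Q \<Longrightarrow> msat M e \<phi>"
  shows "Q_model M"
proof -
  have "\<forall>\<phi>\<in>robinson_Q. msat M e \<phi>" using assms(3) by blast
  then have ax:
    "\<forall>a\<in>univ M. succ M a \<noteq> zero M"
    "\<forall>a\<in>univ M. \<forall>b\<in>univ M. succ M a = succ M b \<longrightarrow> a = b"
    "\<forall>a\<in>univ M. a \<noteq> zero M \<longrightarrow> (\<exists>b\<in>univ M. a = succ M b)"
    "\<forall>a\<in>univ M. plus M a (zero M) = a"
    "\<forall>a\<in>univ M. \<forall>b\<in>univ M. plus M a (succ M b) = succ M (plus M a b)"
    "\<forall>a\<in>univ M. times M a (zero M) = zero M"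
    "\<forall>a\<in>univ M. \<forall>b\<in>univ M. times M a (succ M b) = plus M (times M a b) a"
    "\<forall>a\<in>univ M. \<forall>b\<in>univ M. \<not> ((leq M a b \<longrightarrow> (\<exists>c\<in>univ M. plus M c a = b)) \<longrightarrow>
       \<not> ((\<exists>c\<in>univ M. plus M c a = b) \<longrightarrow> leq M a b))"
    unfolding robinson_Q_def ball_simps by (simp_all add: numeral_2_eq_2)
  show ?thesis
  proof
    show "wf_model M" by (rule assms(1))
    show "leq M a b \<longleftrightarrow> (\<exists>c\<in>univ M. plus M c a = b)" if "a \<in> univ M" "b \<in> univ M" for a b
      using ax(8) that by blast
  qed (use ax(1-7) in blast)+
qed

section \<open>Sigma-1 predicates of the standard model\<close>

text \<open>
  Definability is treated through predicates of assignments, so that closure properties need no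
  formulas. A binder over \<open>x\<close> takes a predicate \<open>P x e\<close>; its body is definable when
  \<open>P (e 0) (\<lambda>i. e (Suc i))\<close> is a definable predicate of \<open>e\<close>, as prescribed by de Bruijn indices.
\<close>

definition polynomial :: "((nat \<Rightarrow> nat) \<Rightarrow> nat) \<Rightarrow> bool" where
  "polynomial f \<longleftrightarrow> (\<exists>t. \<forall>e. f e = val e t)"

definition Delta0 :: "((nat \<Rightarrow> nat) \<Rightarrow> bool) \<Rightarrow> bool" where
  "Delta0 P \<longleftrightarrow> (\<exists>\<phi>\<in>delta0. \<forall>e. P e \<longleftrightarrow> sat e \<phi>)"

text \<open>
  \<open>\<Sigma>\<^sub>1\<close> definability with one unbounded quantifier. The matrix is required to be monotone in the
  witness \<open>w\<close>, which acts as a common bound for all existential quantifiers; because of this,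
  conjunctions, bounded quantifiers and further existential quantifiers reduce to one quantifier.
\<close>

definition Sigma1 :: "((nat \<Rightarrow> nat) \<Rightarrow> bool) \<Rightarrow> bool" where
  "Sigma1 P \<longleftrightarrow> (\<exists>R. Delta0 (\<lambda>e. R (e 0) (\<lambda>i. e (Suc i))) \<and>
     (\<forall>e w w'. w \<le> w' \<longrightarrow> R w e \<longrightarrow> R w' e) \<and> (\<forall>e. P e \<longleftrightarrow> (\<exists>w. R w e)))"

lemma poly_var: "polynomial (\<lambda>e. e i)"
  unfolding polynomial_def by (rule exI[of _ "Var i"]) simp

lemma poly_zero: "polynomial (\<lambda>e. 0)"
  unfolding polynomial_def by (rule exI[of _ Zero]) simp

lemma poly_Suc: "polynomial f \<Longrightarrow> polynomial (\<lambda>e. Suc (f e))"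
  unfolding polynomial_def by (metis val.simps(3))

lemma poly_const: "polynomial (\<lambda>e. c)"
  by (induction c) (auto intro: poly_zero poly_Suc)

lemma poly_add: "polynomial f \<Longrightarrow> polynomial g \<Longrightarrow> polynomial (\<lambda>e. f e + g e)"
  unfolding polynomial_def by (metis val.simps(4))

lemma poly_mult: "polynomial f \<Longrightarrow> polynomial g \<Longrightarrow> polynomial (\<lambda>e. f e * g e)"
  unfolding polynomial_def by (metis val.simps(5))

lemma poly_substitution:
  assumes "\<And>i. polynomial (\<lambda>e. g e i)"
  shows "\<exists>\<sigma>. \<forall>e. g e = (\<lambda>i. val e (\<sigma> i))"
proof -
  have "\<forall>i. \<exists>t. \<forall>e. g e i = val e t" using assms by (simp add: polynomial_def)
  then obtain \<sigma> where "\<forall>i e. g e i = val e (\<sigma> i)" by metis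
  then show ?thesis by (intro exI[of _ \<sigma>]) auto
qed

lemma poly_compose:
  assumes "polynomial f" "\<And>i. polynomial (\<lambda>e. g e i)"
  shows "polynomial (\<lambda>e. f (g e))"
proof -
  obtain \<sigma> where "\<forall>e. g e = (\<lambda>i. val e (\<sigma> i))" using poly_substitution[of g, OF assms(2)] by blast
  with assms(1) show ?thesis unfolding polynomial_def by (metis val_subst_tm)
qed

lemma poly_shift: "polynomial f \<Longrightarrow> polynomial (\<lambda>e. f (\<lambda>i. e (Suc i)))"
  by (rule poly_compose[where g = "\<lambda>e i. e (Suc i)"]) (auto intro: poly_var)

lemma poly_case_nat:
  "polynomial f \<Longrightarrow> (\<And>i. polynomial (\<lambda>e. g e i)) \<Longrightarrow> polynomial (\<lambda>e. case_nat (f e) (g e) i)"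
  by (cases i) auto

lemma Delta0_compose:
  assumes "Delta0 P" "\<And>i. polynomial (\<lambda>e. g e i)"
  shows "Delta0 (\<lambda>e. P (g e))"
proof -
  obtain \<sigma> where "\<forall>e. g e = (\<lambda>i. val e (\<sigma> i))" using poly_substitution[of g, OF assms(2)] by blast
  with assms(1) show ?thesis unfolding Delta0_def by (metis sat_subst delta0_subst)
qed

lemma Delta0_eq: "polynomial f \<Longrightarrow> polynomial g \<Longrightarrow> Delta0 (\<lambda>e. f e = g e)"
  unfolding Delta0_def polynomial_def by (metis sat.simps(1) delta0.intros(1))

lemma Delta0_le: "polynomial f \<Longrightarrow> polynomial g \<Longrightarrow> Delta0 (\<lambda>e. f e \<le> g e)"
  unfolding Delta0_def polynomial_def by (metis sat.simps(2) delta0.intros(2))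

lemma Delta0_less: "polynomial f \<Longrightarrow> polynomial g \<Longrightarrow> Delta0 (\<lambda>e. f e < g e)"
  unfolding less_eq_Suc_le by (intro Delta0_le poly_Suc)

lemma Delta0_False: "Delta0 (\<lambda>e. False)"
  unfolding Delta0_def using delta0.intros(3) by (intro bexI[of _ Bot]) auto

lemma Delta0_imp: "Delta0 P \<Longrightarrow> Delta0 Q \<Longrightarrow> Delta0 (\<lambda>e. P e \<longrightarrow> Q e)"
  unfolding Delta0_def by (metis sat.simps(4) delta0.intros(4))

lemma Delta0_not: "Delta0 P \<Longrightarrow> Delta0 (\<lambda>e. \<not> P e)"
  using Delta0_imp[OF _ Delta0_False] by simp

lemma Delta0_conj: "Delta0 P \<Longrightarrow> Delta0 Q \<Longrightarrow> Delta0 (\<lambda>e. P e \<and> Q e)"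
  using Delta0_not[OF Delta0_imp[OF _ Delta0_not], of P Q] by simp

lemma Delta0_ball:
  assumes "Delta0 (\<lambda>e. P (e 0) (\<lambda>i. e (Suc i)))" "polynomial f"
  shows "Delta0 (\<lambda>e. \<forall>x\<le>f e. P x e)"
proof -
  obtain \<phi> where \<phi>: "\<phi> \<in> delta0" "\<And>e. P (e 0) (\<lambda>i. e (Suc i)) \<longleftrightarrow> sat e \<phi>"
    using assms(1) by (auto simp: Delta0_def)
  obtain t where t: "\<And>e. f e = val e t" using assms(2) by (auto simp: polynomial_def)
  have "P x e \<longleftrightarrow> sat (case_nat x e) \<phi>" for x e using \<phi>(2)[of "case_nat x e"] by simp
  then have "(\<forall>x\<le>f e. P x e) \<longleftrightarrow> sat e (Forall (Imp (Le (Var 0) (lift_tm t)) \<phi>))" for e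
    by (simp add: t)
  then show ?thesis unfolding Delta0_def using delta0.intros(5)[OF \<phi>(1)] by blast
qed

lemma Delta0_bex:
  assumes "Delta0 (\<lambda>e. P (e 0) (\<lambda>i. e (Suc i)))" "polynomial f"
  shows "Delta0 (\<lambda>e. \<exists>x\<le>f e. P x e)"
  using Delta0_not[OF Delta0_ball[OF Delta0_not[OF assms(1)] assms(2)]] by simp

lemma Sigma1I:
  "Delta0 (\<lambda>e. S (e 0) (\<lambda>i. e (Suc i))) \<Longrightarrow> (\<And>w w' e. S w e \<Longrightarrow> w \<le> w' \<Longrightarrow> S w' e) \<Longrightarrow>
     (\<And>e. P e \<longleftrightarrow> (\<exists>w. S w e)) \<Longrightarrow> Sigma1 P"
  unfolding Sigma1_def by (rule exI[of _ S]) auto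

lemma Sigma1_Delta0: "Delta0 P \<Longrightarrow> Sigma1 P"
  unfolding Sigma1_def
  by (rule exI[of _ "\<lambda>w. P"]) (auto intro: Delta0_compose[where g = "\<lambda>e i. e (Suc i)"] poly_var)

lemma Sigma1_compose:
  assumes "Sigma1 P" "\<And>i. polynomial (\<lambda>e. g e i)"
  shows "Sigma1 (\<lambda>e. P (g e))"
proof -
  obtain R where R: "Delta0 (\<lambda>e. R (e 0) (\<lambda>i. e (Suc i)))"
      "\<forall>e w w'. w \<le> w' \<longrightarrow> R w e \<longrightarrow> R w' e" "\<forall>e. P e \<longleftrightarrow> (\<exists>w. R w e)"
    using assms(1) unfolding Sigma1_def by blast
  have "polynomial (\<lambda>e. case_nat (e 0) (g (\<lambda>i. e (Suc i))) i)" for i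
    by (intro poly_case_nat poly_var poly_shift[OF assms(2)])
  from Delta0_compose[OF R(1), where g = "\<lambda>e. case_nat (e 0) (g (\<lambda>i. e (Suc i)))", OF this]
  have "Delta0 (\<lambda>e. R (e 0) (g (\<lambda>i. e (Suc i))))" by simp
  with R(2,3) show ?thesis unfolding Sigma1_def by (intro exI[of _ "\<lambda>w e. R w (g e)"]) auto
qed

lemma Sigma1_conj:
  assumes "Sigma1 P" "Sigma1 Q"
  shows "Sigma1 (\<lambda>e. P e \<and> Q e)"
proof -
  obtain R where R: "Delta0 (\<lambda>e. R (e 0) (\<lambda>i. e (Suc i)))"
      "\<forall>e w w'. w \<le> w' \<longrightarrow> R w e \<longrightarrow> R w' e" "\<forall>e. P e \<longleftrightarrow> (\<exists>w. R w e)"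
    using assms(1) unfolding Sigma1_def by blast
  obtain S where S: "Delta0 (\<lambda>e. S (e 0) (\<lambda>i. e (Suc i)))"
      "\<forall>e w w'. w \<le> w' \<longrightarrow> S w e \<longrightarrow> S w' e" "\<forall>e. Q e \<longleftrightarrow> (\<exists>w. S w e)"
    using assms(2) unfolding Sigma1_def by blast
  have "(\<exists>w. R w e) \<and> (\<exists>w. S w e) \<longleftrightarrow> (\<exists>w. R w e \<and> S w e)" for e
    using R(2) S(2) by (metis nat_le_linear)
  then show ?thesis unfolding Sigma1_def
    using R S by (intro exI[of _ "\<lambda>w e. R w e \<and> S w e"]) (auto intro: Delta0_conj)
qed

lemma Sigma1_ex:
  assumes "Sigma1 (\<lambda>e. P (e 0) (\<lambda>i. e (Suc i)))"
  shows "Sigma1 (\<lambda>e. \<exists>x. P x e)"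
proof -
  obtain R where R: "Delta0 (\<lambda>e. R (e 0) (\<lambda>i. e (Suc i)))"
      "\<forall>e w w'. w \<le> w' \<longrightarrow> R w e \<longrightarrow> R w' e" "\<forall>e. P (e 0) (\<lambda>i. e (Suc i)) \<longleftrightarrow> (\<exists>w. R w e)"
    using assms(1) unfolding Sigma1_def by blast
  have P: "P x e \<longleftrightarrow> (\<exists>w. R w (case_nat x e))" for x e using R(3)[rule_format, of "case_nat x e"] by simp
  let ?S = "\<lambda>w e. \<exists>x\<le>w. R w (case_nat x e)"
  have "polynomial (\<lambda>e. case_nat (e 1) (case_nat (e 0) (\<lambda>i. e (Suc (Suc i)))) i)" for i
    by (intro poly_case_nat poly_var)
  from Delta0_compose[OF R(1), where g = "\<lambda>e. case_nat (e 1) (case_nat (e 0) (\<lambda>i. e (Suc (Suc i))))", OF this]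
  have "Delta0 (\<lambda>e. R (e 1) (case_nat (e 0) (\<lambda>i. e (Suc (Suc i)))))" by simp
  then have "Delta0 (\<lambda>e. ?S (e 0) (\<lambda>i. e (Suc i)))"
    by (intro Delta0_bex poly_var) simp
  moreover have "?S w e \<Longrightarrow> w \<le> w' \<Longrightarrow> ?S w' e" for w w' e
    using R(2) le_trans by blast
  moreover have "(\<exists>x. P x e) \<longleftrightarrow> (\<exists>w. ?S w e)" for e
  proof
    assume "\<exists>x. P x e"
    then obtain x w where "R w (case_nat x e)" by (auto simp: P)
    then have "R (max x w) (case_nat x e)" using R(2) by (meson max.cobounded2)
    then show "\<exists>w. ?S w e" by (meson max.cobounded1)
  qed (auto simp: P)
  ultimately show ?thesis by (rule Sigma1I[of ?S])
qed

text \<open>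
  Collection: finitely many witnesses have a common bound, which by monotonicity is a witness for
  each instance.
\<close>

lemma Sigma1_ball:
  assumes "Sigma1 (\<lambda>e. P (e 0) (\<lambda>i. e (Suc i)))" "polynomial f"
  shows "Sigma1 (\<lambda>e. \<forall>x<f e. P x e)"
proof -
  obtain R where R: "Delta0 (\<lambda>e. R (e 0) (\<lambda>i. e (Suc i)))"
      "\<forall>e w w'. w \<le> w' \<longrightarrow> R w e \<longrightarrow> R w' e" "\<forall>e. P (e 0) (\<lambda>i. e (Suc i)) \<longleftrightarrow> (\<exists>w. R w e)"
    using assms(1) unfolding Sigma1_def by blast
  have P: "P x e \<longleftrightarrow> (\<exists>w. R w (case_nat x e))" for x e using R(3)[rule_format, of "case_nat x e"] by simp
  let ?S = "\<lambda>w e. \<forall>x\<le>f e. x < f e \<longrightarrow> R w (case_nat x e)"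
  have "polynomial (\<lambda>e. case_nat (e 1) (case_nat (e 0) (\<lambda>i. e (Suc (Suc i)))) i)" for i
    by (intro poly_case_nat poly_var)
  from Delta0_compose[OF R(1), where g = "\<lambda>e. case_nat (e 1) (case_nat (e 0) (\<lambda>i. e (Suc (Suc i))))", OF this]
  have "Delta0 (\<lambda>e. R (e 1) (case_nat (e 0) (\<lambda>i. e (Suc (Suc i)))))" by simp
  moreover note poly_shift[OF assms(2)] poly_shift[OF poly_shift[OF assms(2)]]
  ultimately have "Delta0 (\<lambda>e. ?S (e 0) (\<lambda>i. e (Suc i)))"
    by (intro Delta0_ball Delta0_imp Delta0_less poly_var) simp_all
  moreover have "?S w e \<Longrightarrow> w \<le> w' \<Longrightarrow> ?S w' e" for w w' e
    using R(2) by blast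
  moreover have "(\<forall>x<f e. P x e) \<longleftrightarrow> (\<exists>w. ?S w e)" for e
  proof
    assume *: "\<forall>x<f e. P x e"
    have "\<exists>w. \<forall>x<k. R w (case_nat x e)" if "k \<le> f e" for k
      using that
    proof (induction k)
      case (Suc k)
      then obtain w where w: "\<forall>x<k. R w (case_nat x e)" by auto
      from Suc * have "P k e" by simp
      then obtain w' where "R w' (case_nat k e)" by (auto simp: P)
      then have "\<forall>x<Suc k. R (max w w') (case_nat x e)"
        using w R(2) by (metis less_antisym max.cobounded1 max.cobounded2)
      then show ?case by blast
    qed simp
    from this[of "f e"] show "\<exists>w. ?S w e" by auto
  qed (use P less_imp_le in blast)
  ultimately show ?thesis by (rule Sigma1I[of ?S])
qed

section \<open>Goedel's beta function\<close>

definition beta :: "nat \<Rightarrow> nat \<Rightarrow> nat \<Rightarrow> nat" where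
  "beta a b i = a mod Suc (Suc i * b)"

text \<open>
  Take \<open>b = k!\<close> with \<open>k\<close> greater than \<open>m\<close> and at least every value \<open>s i\<close>. A common prime factor of
  \<open>1 + (i + 1) b\<close> and \<open>1 + (j + 1) b\<close> divides \<open>(j - i) b\<close>, hence \<open>b\<close>, as \<open>j - i\<close> divides \<open>b\<close>, hence \<open>1\<close>. So the moduli are coprime, and the Chinese
  remainder theorem gives \<open>a\<close>.
\<close>

lemma beta_exists: "\<exists>a b. \<forall>i\<le>m. beta a b i = s i"
proof -
  define b :: nat where "b = fact (Max (insert (Suc m) (s ` {..m})))"
  let ?c = "\<lambda>i. Suc (Suc i * b)"
  have big: "k \<le> b" if "k \<le> Max (insert (Suc m) (s ` {..m}))" for k
    unfolding b_def using that fact_ge_self le_trans by blast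
  have "coprime (?c i) (?c j)" if "i \<le> m" "j \<le> m" "i < j" for i j
  proof (rule ccontr)
    assume "\<not> coprime (?c i) (?c j)"
    then obtain p :: nat where p: "prime p" "p dvd ?c i" "p dvd ?c j"
      using prime_factor_nat[of "gcd (?c i) (?c j)"] by (auto simp: coprime_iff_gcd_eq_1)
    have "p dvd ?c j - ?c i" using p by (intro dvd_diff_nat)
    moreover have "?c j - ?c i = (j - i) * b" by (simp add: diff_mult_distrib)
    ultimately have "p dvd j - i \<or> p dvd b" using p(1) by (simp add: prime_dvd_mult_iff)
    moreover have "j - i dvd b"
    proof -
      have "j - i \<le> Max (insert (Suc m) (s ` {..m}))"
        using that by (intro order.trans[OF _ Max_ge[of _ "Suc m"]]) auto
      then show ?thesis unfolding b_def using that by (intro dvd_fact) auto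
    qed
    ultimately have "p dvd b" using dvd_trans by blast
    then have "p dvd Suc i * b" by (rule dvd_mult)
    with p(2) have "p dvd 1" using dvd_diff_nat[of p "?c i" "Suc i * b"] by simp
    with p(1) show False using not_prime_unit by blast
  qed
  then have "\<forall>i\<in>{..m}. \<forall>j\<in>{..m}. i \<noteq> j \<longrightarrow> coprime (?c i) (?c j)"
    by (metis atMost_iff coprime_commute nat_neq_iff)
  from chinese_remainder_nat[OF _ this, of s]
  obtain a where a: "\<forall>i\<in>{..m}. [a = s i] (mod ?c i)" by auto
  have "beta a b i = s i" if "i \<le> m" for i
  proof -
    have "s i \<le> b" using that by (intro big Max_ge) auto
    also have "b < ?c i" by simp
    finally show ?thesis using a that by (simp add: beta_def cong_def)
  qed
  then show ?thesis by blast
qed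

lemma Delta0_beta:
  assumes "polynomial a" "polynomial b" "polynomial i" "polynomial y"
  shows "Delta0 (\<lambda>e. beta (a e) (b e) (i e) = y e)"
proof -
  have "beta a b i = y \<longleftrightarrow> y < Suc (Suc i * b) \<and> (\<exists>q\<le>a. a = q * Suc (Suc i * b) + y)" (is "?l \<longleftrightarrow> ?r")
    for a b i y
  proof
    assume ?l
    then have "a = a div Suc (Suc i * b) * Suc (Suc i * b) + y"
      unfolding beta_def by (metis div_mult_mod_eq)
    moreover have "a div Suc (Suc i * b) \<le> a" by (rule div_le_dividend)
    moreover have "y < Suc (Suc i * b)" using \<open>?l\<close> unfolding beta_def by auto
    ultimately show ?r by blast
  next
    assume ?r
    then obtain q where "y < Suc (Suc i * b)" "a = q * Suc (Suc i * b) + y" by blast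
    then show ?l unfolding beta_def by (metis mod_less mod_mult_self3)
  qed
  then show ?thesis
    by simp (intro Delta0_conj Delta0_less Delta0_bex Delta0_eq poly_Suc poly_add poly_mult poly_var
        poly_shift assms)
qed

text \<open>
  The quantifier over the sequence \<open>s\<close>, of which only a finite initial part matters, is replaced by
  two number quantifiers over its beta code.
\<close>

lemma Sigma1_sequence:
  assumes P: "Sigma1 (\<lambda>e. P (e 0) (\<lambda>i. e (Suc i)))"
    and Q: "Sigma1 (\<lambda>e. Q (e 0) (e 1) (e 2) (\<lambda>i. e (Suc (Suc (Suc i)))))"
    and "polynomial m" "polynomial y"
  shows "Sigma1 (\<lambda>e. \<exists>s. P (s 0) e \<and> (\<forall>i<m e. Q i (s i) (s (Suc i)) e) \<and> s (m e) = y e)"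
proof -
  have "(\<exists>s. P (s 0) e \<and> (\<forall>i<m e. Q i (s i) (s (Suc i)) e) \<and> s (m e) = y e) \<longleftrightarrow>
    (\<exists>a b. (\<exists>u. beta a b 0 = u \<and> P u e) \<and>
      (\<forall>i<m e. \<exists>u. beta a b i = u \<and> (\<exists>v. beta a b (Suc i) = v \<and> Q i u v e)) \<and> beta a b (m e) = y e)"
    (is "?l e \<longleftrightarrow> ?r e") for e
  proof
    assume "?l e"
    then obtain s where s: "P (s 0) e" "\<forall>i<m e. Q i (s i) (s (Suc i)) e" "s (m e) = y e" by blast
    obtain a b where "\<forall>i\<le>m e. beta a b i = s i" using beta_exists by blast
    with s show "?r e" by (intro exI[of _ a] exI[of _ b]) simp
  next
    assume "?r e"
    then obtain a b where "P (beta a b 0) e \<and>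
      (\<forall>i<m e. Q i (beta a b i) (beta a b (Suc i)) e) \<and> beta a b (m e) = y e" by blast
    then show "?l e" by (intro exI[of _ "beta a b"])
  qed
  moreover have "Sigma1 ?r"
  proof -
    have g1: "polynomial (\<lambda>e. case_nat (e 0) (\<lambda>i. e (Suc (Suc (Suc i)))) i)" for i
      by (intro poly_case_nat poly_var)
    have g2: "polynomial (\<lambda>e. case_nat (e 2) (case_nat (e 1) (case_nat (e 0) (\<lambda>i. e (Suc (Suc (Suc (Suc (Suc i)))))))) i)" for i
      by (intro poly_case_nat poly_var)
    have P': "Sigma1 (\<lambda>e. P (e 0) (\<lambda>i. e (Suc (Suc (Suc i)))))"
      using Sigma1_compose[OF P, where g = "\<lambda>e. case_nat (e 0) (\<lambda>i. e (Suc (Suc (Suc i))))", OF g1] by simp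
    have Q': "Sigma1 (\<lambda>e. Q (e (Suc (Suc 0))) (e (Suc 0)) (e 0) (\<lambda>i. e (Suc (Suc (Suc (Suc (Suc i)))))))"
      using Sigma1_compose[OF Q, where g = "\<lambda>e. case_nat (e 2) (case_nat (e 1) (case_nat (e 0)
        (\<lambda>i. e (Suc (Suc (Suc (Suc (Suc i))))))))", OF g2] by (simp add: numeral_2_eq_2)
    show ?thesis
      by (intro Sigma1_ex Sigma1_conj Sigma1_ball P' Q' Sigma1_Delta0 Delta0_beta poly_var poly_zero
          poly_Suc poly_shift assms(3,4))
  qed
  ultimately show ?thesis by simp
qed

section \<open>Graphs of recursive functions\<close>

inductive_cases run_PZeroE: "run PZero xs y"
inductive_cases run_PSuccE: "run PSucc xs y"
inductive_cases run_PProjE: "run (PProj i) xs y"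
inductive_cases run_PCompE: "run (PComp p qs) xs y"
inductive_cases run_PRecE: "run (PRec p q) xs y"
inductive_cases run_PMinE: "run (PMin p) xs y"

lemma run_PZero_iff: "run PZero xs y \<longleftrightarrow> y = 0"
  by (auto elim: run_PZeroE intro: run_zero)

lemma run_PSucc_iff: "run PSucc xs y \<longleftrightarrow> (\<exists>x. xs = [x] \<and> y = Suc x)"
  by (auto elim: run_PSuccE intro: run_succ)

lemma run_PProj_iff: "run (PProj i) xs y \<longleftrightarrow> i < length xs \<and> y = xs ! i"
  by (auto elim: run_PProjE intro: run_proj)

lemma run_PComp_iff: "run (PComp p qs) xs z \<longleftrightarrow> (\<exists>ys. list_all2 (\<lambda>q y. run q xs y) qs ys \<and> run p ys z)"
  by (auto elim: run_PCompE intro: run_comp)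

lemma run_PRec_Nil: "\<not> run (PRec p q) [] y"
  by (auto elim: run_PRecE)

lemma run_PRec_0: "run (PRec p q) (0 # xs) y \<longleftrightarrow> run p xs y"
  by (auto elim: run_PRecE intro: run_rec_0)

lemma run_PRec_Suc: "run (PRec p q) (Suc m # xs) z \<longleftrightarrow> (\<exists>y. run (PRec p q) (m # xs) y \<and> run q (m # y # xs) z)"
  by (auto elim: run_PRecE intro: run_rec_Suc)

lemma run_PRec_iff: "run (PRec p q) (m # xs) y \<longleftrightarrow>
  (\<exists>s. run p xs (s 0) \<and> (\<forall>i<m. run q (i # s i # xs) (s (Suc i))) \<and> s m = y)"
proof (induction m arbitrary: y)
  case 0
  have "(\<exists>s :: nat \<Rightarrow> nat. run p xs (s 0) \<and> s 0 = y) \<longleftrightarrow> run p xs y"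
    by (auto intro!: exI[of _ "\<lambda>_. y"])
  then show ?case by (simp add: run_PRec_0)
next
  case (Suc m)
  show ?case
  proof
    assume "run (PRec p q) (Suc m # xs) y"
    then obtain s where s: "run p xs (s 0)" "\<forall>i<m. run q (i # s i # xs) (s (Suc i))" "run q (m # s m # xs) y"
      unfolding run_PRec_Suc Suc by blast
    then show "\<exists>s. run p xs (s 0) \<and> (\<forall>i<Suc m. run q (i # s i # xs) (s (Suc i))) \<and> s (Suc m) = y"
      by (intro exI[of _ "s(Suc m := y)"]) (auto simp: less_Suc_eq)
  next
    assume "\<exists>s. run p xs (s 0) \<and> (\<forall>i<Suc m. run q (i # s i # xs) (s (Suc i))) \<and> s (Suc m) = y"
    then obtain s where s: "run p xs (s 0)" "\<forall>i<Suc m. run q (i # s i # xs) (s (Suc i))" "s (Suc m) = y"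
      by blast
    then have "run (PRec p q) (m # xs) (s m)" unfolding Suc by (intro exI[of _ s]) simp
    with s show "run (PRec p q) (Suc m # xs) y" unfolding run_PRec_Suc by blast
  qed
qed

lemma run_PMin_iff: "run (PMin p) xs m \<longleftrightarrow> run p (m # xs) 0 \<and> (\<forall>i<m. \<exists>y. run p (i # xs) (Suc y))"
  by (auto elim: run_PMinE intro: run_min)

definition Sigma1_prog :: "prog \<Rightarrow> bool" where
  "Sigma1_prog p \<longleftrightarrow> (\<forall>ts b. Sigma1 (\<lambda>e. run p (map (val e) ts) (val e b)))"

lemma val_shift: "val (\<lambda>i. e (Suc i)) = (\<lambda>t. val e (lift_tm t))"
  by (simp add: lift_tm_def val_subst_tm)

lemma poly_val: "polynomial (\<lambda>e. val e t)"
  by (auto simp: polynomial_def)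

lemma Sigma1_progD: "Sigma1_prog p \<Longrightarrow> Sigma1 (\<lambda>e. run p (map (val e) ts) (val e b))"
  by (simp add: Sigma1_prog_def)

text \<open>
  One existential quantifier per argument of the composition. The values already computed are
  collected in \<open>us\<close>, which makes the induction over \<open>qs\<close> go through.
\<close>

lemma Sigma1_run_list:
  assumes "\<And>q. q \<in> set qs \<Longrightarrow> Sigma1_prog q" "Sigma1_prog p"
  shows "Sigma1 (\<lambda>e. \<exists>ys. list_all2 (\<lambda>q y. run q (map (val e) ts) y) qs ys \<and>
    run p (map (val e) us @ ys) (val e b))"
  using assms
proof (induction qs arbitrary: ts us b)
  case Nil
  then show ?case by (simp add: Sigma1_progD)
next
  case (Cons q qs)
  have "Sigma1 (\<lambda>e. \<exists>y. run q (map (val e) ts) y \<and> (\<exists>ys. list_all2 (\<lambda>q y. run q (map (val e) ts) y) qs ys \<and>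
    run p (map (val e) us @ y # ys) (val e b)))"
  proof (rule Sigma1_ex, rule Sigma1_conj)
    show "Sigma1 (\<lambda>e. run q (map (val (\<lambda>i. e (Suc i))) ts) (e 0))"
      using Sigma1_progD[of q "map lift_tm ts" "Var 0"] Cons.prems by (simp add: val_shift comp_def)
    show "Sigma1 (\<lambda>e. \<exists>ys. list_all2 (\<lambda>q. run q (map (val (\<lambda>i. e (Suc i))) ts)) qs ys \<and>
        run p (map (val (\<lambda>i. e (Suc i))) us @ e 0 # ys) (val (\<lambda>i. e (Suc i)) b))"
      using Cons.IH[of "map lift_tm ts" "map lift_tm us @ [Var 0]" "lift_tm b"] Cons.prems
      by (simp add: val_shift comp_def)
  qed
  moreover have "(\<exists>ys. list_all2 (\<lambda>q y. run q (map (val e) ts) y) (q # qs) ys \<and>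
      run p (map (val e) us @ ys) (val e b)) \<longleftrightarrow>
    (\<exists>y. run q (map (val e) ts) y \<and> (\<exists>ys. list_all2 (\<lambda>q y. run q (map (val e) ts) y) qs ys \<and>
      run p (map (val e) us @ y # ys) (val e b)))" for e
    by (auto simp: list_all2_Cons1)
  ultimately show ?case by simp
qed

lemma Sigma1_prog: "Sigma1_prog p"
proof (induction p)
  case PZero
  show ?case unfolding Sigma1_prog_def run_PZero_iff
    by (intro allI Sigma1_Delta0 Delta0_eq poly_val poly_zero)
next
  case PSucc
  have "Sigma1 (\<lambda>e. \<exists>x. map (val e) ts = [x] \<and> val e b = Suc x)" for ts b
  proof (cases "\<exists>t. ts = [t]")
    case True
    then obtain t where "ts = [t]" by blast
    then show ?thesis by simp (intro Sigma1_Delta0 Delta0_eq poly_val poly_Suc)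
  next
    case False
    then have "\<nexists>x. map (val e) ts = [x]" for e by auto
    then show ?thesis by (simp add: Sigma1_Delta0 Delta0_False)
  qed
  then show ?case by (simp add: Sigma1_prog_def run_PSucc_iff)
next
  case (PProj i)
  have "Sigma1 (\<lambda>e. i < length ts \<and> val e b = map (val e) ts ! i)" for ts b
  proof (cases "i < length ts")
    case True
    then show ?thesis by simp (intro Sigma1_Delta0 Delta0_eq poly_val)
  qed (simp add: Sigma1_Delta0 Delta0_False)
  then show ?case by (simp add: Sigma1_prog_def run_PProj_iff)
next
  case (PComp p qs)
  then show ?case
    using Sigma1_run_list[of qs p _ "[]"] by (simp add: Sigma1_prog_def run_PComp_iff)
next
  case (PRec p q)
  have "Sigma1 (\<lambda>e. run (PRec p q) (map (val e) ts) (val e b))" for ts b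
  proof (cases ts)
    case Nil
    then show ?thesis by (simp add: run_PRec_Nil Sigma1_Delta0 Delta0_False)
  next
    case (Cons t us)
    have "Sigma1 (\<lambda>e. \<exists>s. run p (map (val e) us) (s 0) \<and>
      (\<forall>i<val e t. run q (i # s i # map (val e) us) (s (Suc i))) \<and> s (val e t) = val e b)"
    proof (rule Sigma1_sequence)
      show "Sigma1 (\<lambda>e. run p (map (val (\<lambda>i. e (Suc i))) us) (e 0))"
        using Sigma1_progD[OF PRec.IH(1), of "map lift_tm us" "Var 0"] by (simp add: val_shift comp_def)
      show "Sigma1 (\<lambda>e. run q (e 0 # e 1 # map (val (\<lambda>i. e (Suc (Suc (Suc i))))) us) (e 2))"
        using Sigma1_progD[OF PRec.IH(2), of
            "Var 0 # Var 1 # map (subst_tm (\<lambda>i. Var (Suc (Suc (Suc i))))) us" "Var 2"]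
        by (simp add: val_subst_tm comp_def)
    qed (auto intro: poly_val)
    then show ?thesis by (simp add: Cons run_PRec_iff)
  qed
  then show ?case by (simp add: Sigma1_prog_def)
next
  case (PMin p)
  have "Sigma1 (\<lambda>e. run p (val e b # map (val e) ts) 0 \<and>
    (\<forall>i<val e b. \<exists>y. run p (i # map (val e) ts) (Suc y)))" for ts b
  proof (intro Sigma1_conj Sigma1_ball Sigma1_ex poly_val)
    show "Sigma1 (\<lambda>e. run p (val e b # map (val e) ts) 0)"
      using Sigma1_progD[OF PMin.IH, of "b # ts" Zero] by simp
    show "Sigma1 (\<lambda>e. run p (e (Suc 0) # map (val (\<lambda>i. e (Suc (Suc i)))) ts) (Suc (e 0)))"
      using Sigma1_progD[OF PMin.IH, of
          "Var (Suc 0) # map (subst_tm (\<lambda>i. Var (Suc (Suc i)))) ts" "Sc (Var 0)"]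
      by (simp add: val_subst_tm comp_def)
  qed
  then show ?case by (simp add: Sigma1_prog_def run_PMin_iff)
qed

definition Sigma1_fun :: "(nat \<Rightarrow> nat) \<Rightarrow> bool" where
  "Sigma1_fun f \<longleftrightarrow> Sigma1 (\<lambda>e. e 0 = f (e 1))"

lemma Sigma1_graph_recursive1: "recursive1 f \<Longrightarrow> Sigma1 (\<lambda>e. e i = f (e j))"
proof -
  assume "recursive1 f"
  then obtain p where "\<And>x y. run p [x] y \<longleftrightarrow> y = f x" by (auto simp: recursive1_def)
  then show ?thesis using Sigma1_progD[OF Sigma1_prog, of p "[Var j]" "Var i"] by simp
qed

lemma Sigma1_graph_recursive2: "recursive2 f \<Longrightarrow> Sigma1 (\<lambda>e. e i = f (e j) (e k))"
proof -
  assume "recursive2 f"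
  then obtain p where "\<And>x x' y. run p [x, x'] y \<longleftrightarrow> y = f x x'" by (auto simp: recursive2_def)
  then show ?thesis using Sigma1_progD[OF Sigma1_prog, of p "[Var j, Var k]" "Var i"] by simp
qed

lemma Sigma1_fun_graph: "Sigma1_fun f \<Longrightarrow> Sigma1 (\<lambda>e. e i = f (e j))"
  using Sigma1_compose[of "\<lambda>e. e 0 = f (e 1)" "\<lambda>e. case_nat (e i) (case_nat (e j) e)"]
  by (simp add: Sigma1_fun_def poly_case_nat poly_var)

lemma Sigma1_fun_id: "Sigma1_fun (\<lambda>x. x)"
  unfolding Sigma1_fun_def by (intro Sigma1_Delta0 Delta0_eq poly_var)

lemma Sigma1_fun_const: "Sigma1_fun (\<lambda>x. c)"
  unfolding Sigma1_fun_def by (intro Sigma1_Delta0 Delta0_eq poly_var poly_const)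

lemma Sigma1_fun_comp1:
  assumes "recursive1 g" "Sigma1_fun f"
  shows "Sigma1_fun (\<lambda>x. g (f x))"
proof -
  have "Sigma1 (\<lambda>e. \<exists>u. u = f (e 1) \<and> e 0 = g u)"
    by (intro Sigma1_ex Sigma1_conj Sigma1_fun_graph[OF assms(2)] Sigma1_graph_recursive1[OF assms(1)])
  then show ?thesis by (simp add: Sigma1_fun_def)
qed

lemma Sigma1_fun_comp2:
  assumes "recursive2 g" "Sigma1_fun f" "Sigma1_fun f'"
  shows "Sigma1_fun (\<lambda>x. g (f x) (f' x))"
proof -
  have "Sigma1 (\<lambda>e. \<exists>u. u = f (e 1) \<and> (\<exists>v. v = f' (e 1) \<and> e 0 = g u v))"
    by (intro Sigma1_ex Sigma1_conj Sigma1_fun_graph[OF assms(2)] Sigma1_fun_graph[OF assms(3)]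
        Sigma1_graph_recursive2[OF assms(1)])
  then show ?thesis by (simp add: Sigma1_fun_def)
qed

lemma Sigma1_fun_iterate:
  assumes "recursive1 g"
  shows "Sigma1_fun (\<lambda>k. (g ^^ k) c)"
proof -
  have "(\<exists>s. s 0 = c \<and> (\<forall>i<k. s (Suc i) = g (s i)) \<and> s k = y) \<longleftrightarrow> y = (g ^^ k) c" for k y
  proof
    assume "\<exists>s. s 0 = c \<and> (\<forall>i<k. s (Suc i) = g (s i)) \<and> s k = y"
    then obtain s where s: "s 0 = c" "\<forall>i<k. s (Suc i) = g (s i)" "s k = y" by blast
    have "i \<le> k \<Longrightarrow> s i = (g ^^ i) c" for i by (induction i) (auto simp: s)
    with s(3) show "y = (g ^^ k) c" by auto
  qed (auto intro!: exI[of _ "\<lambda>i. (g ^^ i) c"])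
  moreover have "Sigma1 (\<lambda>e. \<exists>s. s 0 = c \<and> (\<forall>i<e 1. s (Suc i) = g (s i)) \<and> s (e 1) = e 0)"
    by (rule Sigma1_sequence) (intro Sigma1_Delta0 Delta0_eq Sigma1_graph_recursive1 assms poly_var poly_const)+
  ultimately show ?thesis by (simp add: Sigma1_fun_def)
qed

section \<open>Representability\<close>

text \<open>
  Let \<open>A(w, y, x)\<close> be a bounded formula such that \<open>y = f x\<close> holds iff \<open>A(w, y, x)\<close> holds for some \<open>w\<close>.
  The formula \<open>D(y, x)\<close> says that there is \<open>w \<ge> y\<close> with \<open>A(w, y, x)\<close> such that \<open>A(w', y', x)\<close> fails for all
  \<open>y' \<le> w' \<le> w\<close> with \<open>w' \<noteq> w\<close>. Let \<open>w0\<close> be the least number with \<open>w0 \<ge> f x\<close> and \<open>A(w0, f x, x)\<close>.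
  In a model of \<open>Q\<close> any \<open>w\<close> is comparable with the numeral \<open>w0\<close>. If \<open>w \<le> w0\<close>, then \<open>w\<close> and
  \<open>y\<close> are numerals and absoluteness gives \<open>y = f x\<close>. If \<open>w0 \<le> w\<close>, then \<open>w = w0\<close>, since the witness \<open>w0\<close> would otherwise contradict the choice of \<open>w\<close>.
\<close>

theorem representable:
  assumes "Sigma1_fun f"
  shows "\<exists>D\<in>Sigma_class 1. fv D \<subseteq> {0, 1} \<and>
    (\<forall>(M :: tm model) e a k. Q_model M \<longrightarrow> e \<in> envs M \<longrightarrow> a \<in> univ M \<longrightarrow>
      (msat M (case_nat a (case_nat (num M k) e)) D \<longleftrightarrow> a = num M (f k)))"
proof -
  obtain R where R: "Delta0 (\<lambda>e. R (e 0) (\<lambda>i. e (Suc i)))"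
      "\<forall>e w w'. w \<le> w' \<longrightarrow> R w e \<longrightarrow> R w' e" "\<forall>e. e 0 = f (e 1) \<longleftrightarrow> (\<exists>w. R w e)"
    using assms unfolding Sigma1_fun_def Sigma1_def by blast
  then obtain A' where A': "A' \<in> delta0" "\<And>e. R (e 0) (\<lambda>i. e (Suc i)) \<longleftrightarrow> sat e A'"
    by (auto simp: Delta0_def)
  \<comment> \<open>Only the witness, the value and the argument may stay free. Substituting \<open>0\<close> for the other
    variables is harmless, because \<open>e 0 = f (e 1) \<longleftrightarrow> (\<exists>w. R w e)\<close> holds for all assignments \<open>e\<close>.\<close>
  define A where "A = subst (\<lambda>i. if i < 3 then Var i else Zero) A'"
  define holds where "holds w y x \<longleftrightarrow> R w (case_nat y (case_nat x (\<lambda>_. 0)))" for w y x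
  have A: "A \<in> delta0" using A'(1) by (simp add: A_def delta0_subst)
  have fv_A: "fv A \<subseteq> {0, 1, 2}" by (auto simp: A_def fv_subst split: if_splits)
  have sat_A: "sat (case_nat w (case_nat y (case_nat x e))) A \<longleftrightarrow> holds w y x" for w y x e
  proof -
    have "(\<lambda>i. val (case_nat w (case_nat y (case_nat x e))) (if i < 3 then Var i else Zero)) =
        case_nat w (case_nat y (case_nat x (\<lambda>_. 0)))"
      by (rule ext) (auto split: nat.split)
    then show ?thesis
      using A'(2)[of "case_nat w (case_nat y (case_nat x (\<lambda>_. 0)))"]
      by (simp add: A_def sat_subst holds_def)
  qed
  have mono: "holds w' y x" if "holds w y x" "w \<le> w'" for w w' y x
    using that R(2) unfolding holds_def by blast
  have graph: "y = f x \<longleftrightarrow> (\<exists>w. holds w y x)" for x y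
    using R(3)[rule_format, of "case_nat y (case_nat x (\<lambda>_. 0))"] by (simp add: holds_def)
  \<comment> \<open>\<open>A(w', y', x)\<close> under the additional binders for \<open>w'\<close> and \<open>y'\<close>, where the indices \<open>0, 1, 2, 3, 4\<close>
    stand for \<open>y', w', w, y, x\<close>\<close>
  define B where "B = subst (\<lambda>i. if i = 0 then Var 1 else if i = 1 then Var 0 else Var (Suc (Suc i))) A"
  define least where "least =
    Forall (Imp (Le (Var 0) (lift_tm (Var 0))) (Or (Eq (Var 0) (Var 1))
      (Forall (Imp (Le (Var 0) (lift_tm (Var 0))) (Neg B)))))"
  define D where "D = Exists (And (And (Le (Var 1) (Var 0)) A) least)"
  have "And (And (Le (Var 1) (Var 0)) A) least \<in> delta0"
    unfolding least_def B_def by (intro delta0.intros delta0_subst A)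
  then have "And (And (Le (Var 1) (Var 0)) A) least \<in> Sigma_class 0"
    unfolding Sigma_class_iff sigma_prenex.simps using equivalent_refl by blast
  then have "D \<in> Sigma_class 1"
    unfolding D_def One_nat_def using Sigma_mono[of 0 "Suc 0"] by (intro Exists_Sigma_Suc) auto
  moreover have "fv D \<subseteq> {0, 1}"
    using fv_A by (auto simp: D_def least_def B_def fv_subst lift_tm_def split: if_splits)
  moreover have "msat M (case_nat a (case_nat (num M k) e)) D \<longleftrightarrow> a = num M (f k)"
    if M: "Q_model M" and e: "e \<in> envs M" and a: "a \<in> univ M" for M :: "tm model" and e a k
  proof -
    interpret Q_model M by (rule M)
    define H where "H w y \<longleftrightarrow> msat M (case_nat w (case_nat y (case_nat (num M k) e))) A" for w y
    have H_num: "H (num M w) (num M y) \<longleftrightarrow> holds w y k" for w y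
    proof -
      have "H (num M w) (num M y) \<longleftrightarrow>
        msat M (\<lambda>i. num M (case_nat w (case_nat y (case_nat k (\<lambda>_. 0))) i)) A"
        unfolding H_def
      proof (rule msat_cong)
        fix i assume "i \<in> fv A"
        then have "i = 0 \<or> i = 1 \<or> i = 2" using fv_A by auto
        then show "case_nat (num M w) (case_nat (num M y) (case_nat (num M k) e)) i =
          num M (case_nat w (case_nat y (case_nat k (\<lambda>_. 0))) i)" by (auto simp: numeral_2_eq_2)
      qed
      then show ?thesis using delta0_absolute[OF A] sat_A by simp
    qed
    have B: "msat M (case_nat y (case_nat w' (case_nat w (case_nat a (case_nat (num M k) e))))) B \<longleftrightarrow> H w' y" for w w' y
    proof -
      have "(\<lambda>i. mval M (case_nat y (case_nat w' (case_nat w (case_nat a (case_nat (num M k) e)))))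
          (if i = 0 then Var 1 else if i = 1 then Var 0 else Var (Suc (Suc i)))) =
        case_nat w' (case_nat y (case_nat (num M k) e))"
        by (rule ext) (auto split: nat.split)
      then show ?thesis by (simp add: B_def msat_subst H_def)
    qed
    have D: "msat M (case_nat a (case_nat (num M k) e)) D \<longleftrightarrow>
      (\<exists>w\<in>univ M. leq M a w \<and> H w a \<and>
        (\<forall>w'\<in>univ M. leq M w' w \<longrightarrow> w' = w \<or> (\<forall>y\<in>univ M. leq M y w' \<longrightarrow> \<not> H w' y)))"
      by (auto simp: D_def least_def lift_tm_def B H_def[symmetric])
    obtain w1 where "holds w1 (f k) k" using graph by blast
    \<comment> \<open>a witness can be enlarged until it bounds the value as well\<close>
    then have ex: "\<exists>w. f k \<le> w \<and> holds w (f k) k"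
      using mono by (intro exI[of _ "max (f k) w1"]) auto
    define w0 where "w0 = (LEAST w. f k \<le> w \<and> holds w (f k) k)"
    have w0: "f k \<le> w0" "holds w0 (f k) k"
      using LeastI_ex[OF ex] by (auto simp: w0_def)
    have below: "\<not> holds w y k" if "w < w0" "y \<le> w" for w y
    proof
      assume "holds w y k"
      moreover from this have "y = f k" using graph by blast
      ultimately show False
        using not_less_Least[of w "\<lambda>w. f k \<le> w \<and> holds w (f k) k"] that by (simp add: w0_def)
    qed
    have standard: "a = num M (f k)" if w: "w \<in> univ M" "leq M w (num M w0)" "leq M a w" "H w a" for w
    proof -
      obtain j where "w = num M j" using below_num w(1,2) by blast
      moreover then obtain l where "a = num M l" using below_num a w(3) by blast
      ultimately show ?thesis using w(4) graph[of l k] by (auto simp: H_num)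
    qed
    show ?thesis
    proof
      assume "msat M (case_nat a (case_nat (num M k) e)) D"
      then obtain w where w: "w \<in> univ M" "leq M a w" "H w a"
        and least: "\<And>w'. w' \<in> univ M \<Longrightarrow> leq M w' w \<Longrightarrow> w' = w \<or> (\<forall>y\<in>univ M. leq M y w' \<longrightarrow> \<not> H w' y)"
        unfolding D by blast
      from num_linear[OF w(1), of w0] show "a = num M (f k)"
      proof
        assume "leq M (num M w0) w"
        moreover have "H (num M w0) (num M (f k))" "leq M (num M (f k)) (num M w0)"
          using w0 by (simp_all add: H_num num_leq)
        ultimately have "num M w0 = w" using least[OF num_closed] num_closed by blast
        then show ?thesis using standard[OF w(1) _ w(2,3)] num_leq by auto
      qed (use standard w in blast)
    next
      assume *: "a = num M (f k)"
      show "msat M (case_nat a (case_nat (num M k) e)) D"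
        unfolding D
      proof (intro bexI conjI ballI impI)
        show "leq M a (num M w0)" "H (num M w0) a" using w0 by (simp_all add: * H_num num_leq)
        fix w assume w: "w \<in> univ M" "leq M w (num M w0)"
        then obtain j where j: "j \<le> w0" "w = num M j" using below_num by blast
        show "w = num M w0 \<or> (\<forall>y\<in>univ M. leq M y w \<longrightarrow> \<not> H w y)"
        proof (cases "j = w0")
          case False
          have "\<not> H w y" if y: "y \<in> univ M" "leq M y w" for y
          proof -
            obtain l where "l \<le> j" "y = num M l" using below_num y j(2) by blast
            then show ?thesis using below[of j l] j False by (simp add: H_num)
          qed
          then show ?thesis by blast
        qed (simp add: j)
      qed simp
    qed
  qed
  ultimately show ?thesis by blast
qed

section \<open>Goedelian sentences\<close>

lemma Sigma1_fun_numeral_code: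
  assumes "goedel_numbering gt gf"
  shows "Sigma1_fun (\<lambda>k. gt (numeral_tm k))"
proof -
  obtain g where g: "recursive1 g" "\<And>t. gt (Sc t) = g (gt t)"
    using assms by (auto simp: goedel_numbering_def)
  have "gt (numeral_tm k) = (g ^^ k) (gt Zero)" for k
    by (induction k) (simp_all add: numeral_tm_def g(2))
  with Sigma1_fun_iterate[OF g(1)] show ?thesis by simp
qed

text \<open>
  The function that takes the code of \<open>F\<close> to the code of \<open>\<phi> \<and> (\<forall>x. x = #F \<longrightarrow> F(x))\<close>. It is a composition of
  constructors and the code of a numeral, once the conjunction is spelled out with implication and \<open>\<bottom>\<close>.
\<close>

lemma Sigma1_fun_diagonal_code:
  assumes "goedel_numbering gt gf"
  shows "\<exists>d. Sigma1_fun d \<and>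
    (\<forall>F. d (gf F) = gf (And \<phi> (Forall (Imp (Eq (Var 0) (numeral_tm (gf F))) F))))"
proof -
  obtain eq where eq: "recursive2 eq" "\<forall>s t. gf (Eq s t) = eq (gt s) (gt t)"
    using assms unfolding goedel_numbering_def by blast
  obtain imp where imp: "recursive2 imp" "\<forall>\<phi> \<psi>. gf (Imp \<phi> \<psi>) = imp (gf \<phi>) (gf \<psi>)"
    using assms unfolding goedel_numbering_def by blast
  obtain all where all: "recursive1 all" "\<forall>\<phi>. gf (Forall \<phi>) = all (gf \<phi>)"
    using assms unfolding goedel_numbering_def by blast
  let ?d = "\<lambda>x. imp (imp (gf \<phi>) (imp (all (imp (eq (gt (Var 0)) (gt (numeral_tm x))) x)) (gf Bot))) (gf Bot)"
  have "Sigma1_fun (\<lambda>x. eq (gt (Var 0)) (gt (numeral_tm x)))"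
    by (rule Sigma1_fun_comp2[OF eq(1) Sigma1_fun_const Sigma1_fun_numeral_code[OF assms]])
  then have "Sigma1_fun (\<lambda>x. imp (eq (gt (Var 0)) (gt (numeral_tm x))) x)"
    by (rule Sigma1_fun_comp2[OF imp(1) _ Sigma1_fun_id])
  then have "Sigma1_fun (\<lambda>x. all (imp (eq (gt (Var 0)) (gt (numeral_tm x))) x))"
    by (rule Sigma1_fun_comp1[OF all(1)])
  then have "Sigma1_fun (\<lambda>x. imp (all (imp (eq (gt (Var 0)) (gt (numeral_tm x))) x)) (gf Bot))"
    by (rule Sigma1_fun_comp2[OF imp(1) _ Sigma1_fun_const])
  then have "Sigma1_fun (\<lambda>x. imp (gf \<phi>) (imp (all (imp (eq (gt (Var 0)) (gt (numeral_tm x))) x)) (gf Bot)))"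
    by (rule Sigma1_fun_comp2[OF imp(1) Sigma1_fun_const])
  then have "Sigma1_fun ?d"
    by (rule Sigma1_fun_comp2[OF imp(1) _ Sigma1_fun_const])
  then show ?thesis by (intro exI[of _ ?d]) (simp add: eq(2) imp(2) all(2))
qed

lemma msat_at_code: "msat M e (at_code gf Pr \<phi>) \<longleftrightarrow> msat M (case_nat (num M (gf \<phi>)) e) Pr"
  by (simp add: at_code_def msat_inst)

lemma sentence_at_code: "fv Pr \<subseteq> {0} \<Longrightarrow> sentence (at_code gf Pr \<phi>)"
  by (auto simp: sentence_def at_code_def inst_def fv_subst split: nat.splits)

text \<open>
  Diagonalization. Let \<open>D\<close> represent the diagonal function \<open>d\<close>, let \<open>F(x)\<close> be \<open>\<forall>y. D(y, x) \<longrightarrow> \<not> Pr(y)\<close>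
  and let \<open>\<delta>\<close> be \<open>\<forall>x. x = #F \<longrightarrow> F(x)\<close>. In a model of \<open>T\<close> the only \<open>y\<close> with \<open>D(y, #F)\<close> is \<open>d(#F)\<close>, which is
  the code of \<open>\<phi> \<and> \<delta>\<close>, so \<open>\<delta>\<close> holds there iff \<open>\<not> Pr(#(\<phi> \<and> \<delta>))\<close> does. As \<open>\<phi>\<close> holds in the model too, so does
  \<open>\<phi> \<and> \<delta> \<longleftrightarrow> \<not> Pr(#(\<phi> \<and> \<delta>))\<close>.
\<close>

theorem goedelian_conjunct:
  assumes gn: "goedel_numbering gt gf" and T: "re_extension_of_Q gf T"
    and Pr: "fv Pr \<subseteq> {0}" "Pr \<in> Sigma_class 1"
    and \<phi>: "sentence \<phi>" "T \<turnstile> \<phi>"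
  shows "\<exists>\<delta>\<in>Pi_class 1. goedelian gf T Pr (And \<phi> \<delta>)"
proof -
  obtain d where d: "Sigma1_fun d"
      "\<And>F. d (gf F) = gf (And \<phi> (Forall (Imp (Eq (Var 0) (numeral_tm (gf F))) F)))"
    using Sigma1_fun_diagonal_code[OF gn, of \<phi>] by blast
  obtain D where D: "D \<in> Sigma_class 1" "fv D \<subseteq> {0, 1}"
    and rep: "\<And>(M :: tm model) e a k. Q_model M \<Longrightarrow> e \<in> envs M \<Longrightarrow> a \<in> univ M \<Longrightarrow>
      msat M (case_nat a (case_nat (num M k) e)) D \<longleftrightarrow> a = num M (d k)"
    using representable[OF d(1)] by blast
  define F where "F = Forall (Imp D (Neg Pr))"
  define \<delta> where "\<delta> = Forall (Imp (Eq (Var 0) (numeral_tm (gf F))) F)"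
  define \<gamma> where "\<gamma> = And \<phi> \<delta>"
  have code: "d (gf F) = gf \<gamma>" by (simp add: d(2) \<gamma>_def \<delta>_def)
  \<comment> \<open>\<open>D\<close>, \<open>Pr\<close> and the equation are \<open>\<Sigma>\<^sub>1\<close> and occur in \<open>\<delta>\<close> only negatively.\<close>
  have "\<delta> \<in> Pi_class 1"
  proof -
    have "Imp D (Neg Pr) \<in> Pi_class 1"
      using Pi_Or[OF Neg_Sigma[OF D(1)] Neg_Sigma[OF Pr(2)]]
      by (rule Pi_class_equivalent) (auto simp: equivalent_def)
    then have "F \<in> Pi_class 1" unfolding F_def by (simp only: One_nat_def Forall_Pi_Suc)
    moreover have "Neg (Eq (Var 0) (numeral_tm (gf F))) \<in> Pi_class 1"
    proof (rule Neg_Sigma)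
      have "Eq (Var 0) (numeral_tm (gf F)) \<in> Sigma_class 0"
        unfolding Sigma_class_iff sigma_prenex.simps using delta0.intros(1) equivalent_refl by blast
      then show "Eq (Var 0) (numeral_tm (gf F)) \<in> Sigma_class 1" using Sigma_mono[of 0 1] by auto
    qed
    ultimately have "Or (Neg (Eq (Var 0) (numeral_tm (gf F)))) F \<in> Pi_class 1"
      by (intro Pi_Or)
    then have "Imp (Eq (Var 0) (numeral_tm (gf F))) F \<in> Pi_class 1"
      by (rule Pi_class_equivalent) (auto simp: equivalent_def)
    then show ?thesis unfolding \<delta>_def by (simp only: One_nat_def Forall_Pi_Suc)
  qed
  moreover have "sentence \<gamma>"
    using \<phi>(1) D(2) Pr(1) by (auto simp: sentence_def \<gamma>_def \<delta>_def F_def)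
  moreover have "T \<turnstile> Iff \<gamma> (Neg (at_code gf Pr \<gamma>))"
  proof (rule completeness)
    show "\<forall>\<chi>\<in>T. sentence \<chi>" using T by (simp add: re_extension_of_Q_def)
    fix M :: "tm model" and e
    assume M: "wf_model M" "e \<in> envs M" and sat_T: "\<And>\<psi>. \<psi> \<in> T \<Longrightarrow> msat M e \<psi>"
    have T_M: "msat M e \<psi>" if "T \<turnstile> \<psi>" for \<psi>
      using soundness[OF that M] sat_T by blast
    have Q: "Q_model M"
      using Q_model_if_sat[OF M] T_M T by (auto simp: re_extension_of_Q_def)
    interpret Q_model M by (rule Q)
    have "msat M e \<delta> \<longleftrightarrow> msat M (case_nat (num M (gf F)) e) F"
      by (auto simp: \<delta>_def)
    also have "\<dots> \<longleftrightarrow> (\<forall>a\<in>univ M. a = num M (gf \<gamma>) \<longrightarrow> \<not> msat M (case_nat a (case_nat (num M (gf F)) e)) Pr)"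
    proof -
      have "msat M e' F \<longleftrightarrow> (\<forall>a\<in>univ M. msat M (case_nat a e') D \<longrightarrow> \<not> msat M (case_nat a e') Pr)" for e'
        by (simp add: F_def)
      then show ?thesis using rep[OF Q M(2), of _ "gf F"] by (simp add: code)
    qed
    also have "\<dots> \<longleftrightarrow> \<not> msat M (case_nat (num M (gf \<gamma>)) (case_nat (num M (gf F)) e)) Pr"
      by auto
    \<comment> \<open>only index \<open>0\<close> is free in \<open>Pr\<close>, so the value of \<open>x\<close> can be dropped from the assignment\<close>
    also have "\<dots> \<longleftrightarrow> \<not> msat M e (at_code gf Pr \<gamma>)"
      unfolding msat_at_code using Pr(1) by (intro arg_cong[where f = Not] msat_cong) auto
    finally have "msat M e \<gamma> \<longleftrightarrow> \<not> msat M e (at_code gf Pr \<gamma>)"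
      using T_M[OF \<phi>(2)] by (simp add: \<gamma>_def)
    then show "msat M e (Iff \<gamma> (Neg (at_code gf Pr \<gamma>)))" by simp
  qed
  ultimately show ?thesis unfolding goedelian_def \<gamma>_def by blast
qed

lemma goedelian_disjunction:
  assumes "\<forall>\<chi>\<in>T. sentence \<chi>" "goedelian gf T Pr \<gamma>"
  shows "T \<turnstile> Or \<gamma> (at_code gf Pr \<gamma>)"
proof (rule completeness[OF assms(1)])
  fix M :: "tm model" and e
  assume "wf_model M" "e \<in> envs M" "\<And>\<psi>. \<psi> \<in> T \<Longrightarrow> msat M e \<psi>"
  then have "msat M e (Iff \<gamma> (Neg (at_code gf Pr \<gamma>)))"
    using assms(2) soundness unfolding goedelian_def by blast
  then show "msat M e (Or \<gamma> (at_code gf Pr \<gamma>))" by auto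
qed

text \<open>
  The equivalence for any class \<open>C\<close> with the two closure properties that the argument uses.
\<close>

theorem goedelian_true_iff_sound:
  assumes gn: "goedel_numbering gt gf" and T: "re_extension_of_Q gf T"
    and Pr: "provability_predicate gf T Pr"
    and And: "\<And>\<phi> \<delta>. \<phi> \<in> C \<Longrightarrow> \<delta> \<in> Pi_class 1 \<Longrightarrow> And \<phi> \<delta> \<in> C"
    and Or: "\<And>\<phi> \<psi>. \<phi> \<in> C \<Longrightarrow> \<psi> \<in> Sigma_class 1 \<Longrightarrow> Or \<phi> \<psi> \<in> C"
  shows "(\<forall>\<gamma>. goedelian gf T Pr \<gamma> \<and> \<gamma> \<in> C \<longrightarrow> true_in_N \<gamma>) \<longleftrightarrow> sound_for C T"
proof
  have fv_Pr: "fv Pr \<subseteq> {0}" and Sigma_Pr: "Pr \<in> Sigma_class 1"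
    using Pr by (auto simp: provability_predicate_def)
  {
    assume true: "\<forall>\<gamma>. goedelian gf T Pr \<gamma> \<and> \<gamma> \<in> C \<longrightarrow> true_in_N \<gamma>"
    show "sound_for C T"
      unfolding sound_for_def
    proof (intro allI impI)
      fix \<phi> assume \<phi>: "sentence \<phi> \<and> \<phi> \<in> C \<and> T \<turnstile> \<phi>"
      then obtain \<delta> where "\<delta> \<in> Pi_class 1" "goedelian gf T Pr (And \<phi> \<delta>)"
        using goedelian_conjunct[OF gn T fv_Pr Sigma_Pr] by blast
      with true And \<phi> have "true_in_N (And \<phi> \<delta>)" by blast
      then show "true_in_N \<phi>" by (simp add: true_in_N_def)
    qed
  next
    assume sound: "sound_for C T"
    show "\<forall>\<gamma>. goedelian gf T Pr \<gamma> \<and> \<gamma> \<in> C \<longrightarrow> true_in_N \<gamma>"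
    proof (intro allI impI)
      fix \<gamma> assume \<gamma>: "goedelian gf T Pr \<gamma> \<and> \<gamma> \<in> C"
      let ?P = "at_code gf Pr \<gamma>"
      have sent: "sentence \<gamma>" "sentence ?P"
        using \<gamma> sentence_at_code[OF fv_Pr] by (auto simp: goedelian_def)
      have "?P \<in> Sigma_class 1"
        using Sigma_Pr by (simp add: at_code_def inst_def Sigma_subst)
      then have "Or \<gamma> ?P \<in> C" using Or \<gamma> by blast
      moreover have "sentence (Or \<gamma> ?P)" using sent by (simp add: sentence_def)
      moreover have "T \<turnstile> Or \<gamma> ?P" using \<gamma> T goedelian_disjunction unfolding re_extension_of_Q_def by blast
      ultimately have "true_in_N (Or \<gamma> ?P)" using sound unfolding sound_for_def by blast
      then have "sat (\<lambda>_. 0) (Or \<gamma> ?P)" unfolding true_in_N_def by blast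
      then have "true_in_N \<gamma> \<or> true_in_N ?P"
        unfolding sat.simps sat_sentence[OF sent(1)] sat_sentence[OF sent(2)] by blast
      moreover have "true_in_N \<gamma>" if "true_in_N ?P"
      proof -
        have "T \<turnstile> \<gamma>" using that Pr sent(1) by (simp add: provability_predicate_def)
        then show ?thesis using sound sent(1) \<gamma> by (simp add: sound_for_def)
      qed
      ultimately show "true_in_N \<gamma>" by blast
    qed
  }
qed

theorem theorem2p8:
  fixes gt :: "tm \<Rightarrow> nat" and gf :: "fm \<Rightarrow> nat" and T :: "fm set" and Pr :: fm and n :: nat
  assumes "goedel_numbering gt gf"
    and "re_extension_of_Q gf T"
    and "provability_predicate gf T Pr"
    and "n \<ge> 1"
  shows "((\<forall>\<gamma>. goedelian gf T Pr \<gamma> \<and> \<gamma> \<in> Pi_class (n + 1) \<longrightarrow> true_in_N \<gamma>)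
            \<longleftrightarrow> sound_for (Pi_class (n + 1)) T)
       \<and> ((\<forall>\<gamma>. goedelian gf T Pr \<gamma> \<and> \<gamma> \<in> Sigma_class (n + 1) \<longrightarrow> true_in_N \<gamma>)
            \<longleftrightarrow> sound_for (Sigma_class (n + 1)) T)"
proof -
  have "Sigma_class 1 \<subseteq> Pi_class (n + 1) \<inter> Sigma_class (n + 1)"
    "Pi_class 1 \<subseteq> Pi_class (n + 1) \<inter> Sigma_class (n + 1)"
    using Sigma_mono[of 1 n] Sigma_mono[of 1 "n + 1"] Pi_mono[of 1 n] Pi_mono[of 1 "n + 1"]
      Sigma_subset_Pi_Suc[of n] Pi_subset_Sigma_Suc[of n] assms(4) by auto
  then show ?thesis
    by (intro conjI goedelian_true_iff_sound[OF assms(1-3)] Pi_And Pi_Or Sigma_And Sigma_Or) auto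
qed

end
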